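(* Suppose there is a bi-Lipschitz embedding $C_\alpha\hookrightarrow C_\beta$ for some irrationals $\alpha,\beta\in\mathbb{R}/\mathbb{Z}$. Then $\alpha=\beta$.
   Context: Let $\mathbb{H}^4$ be the upper half-space model of hyperbolic 4-space with hyperbolic distance $\rho$, using coordinates $(r,\theta,z,t)$, where $(r,\theta,z)$ are cylindrical coordinates of $\mathbb{R}^3$ with the polar angle measured in full turns, $\theta\in\mathbb{R}/\mathbb{Z}$, and $t>0$. Fix $\varepsilon$ with $0<\varepsilon\le\varepsilon_4$, where $\varepsilon_4$ is the Margulis constant of $\mathbb{H}^4$. For irrational $\alpha\in\mathbb{R}/\mathbb{Z}$, let $g_\alpha(r,\theta,z,t)=(r,\theta+\alpha,z+1,t)$, an isometry of $\mathbb{H}^4$ (an irrational screw translation). The Margulis region is $$T_\alpha=\bigcup_{j\ge1}\{x\in\mathbb{H}^4:\rho(g_\alpha^j(x),x)<\varepsilon\}=\{(r,\theta,z,t):t>\mathscr{B}_\alpha(r)\},$$ where $\mathscr{B}_\alpha(r)=\inf_{j\ge1}c(\varepsilon)\sqrt{4\sin^2(\pi j\alpha)\,r^2+j^2}$ and $c(\varepsilon)=1/\sqrt{2\cosh(\varepsilon)-2}$. It is invariant under $g_\alpha$, and the Margulis cusp is the quotient $C_\alpha=T_\alpha/\langle g_\alpha\rangle$, with the metric induced from the hyperbolic metric of $\mathbb{H}^4$. A homeomorphism $\varphi:X\to Y$ between metric spaces is bi-Lipschitz if there is a constant $k\ge1$ such that $k^{-1}d_X(x,\hat x)\le d_Y(\varphi(x),\varphi(\hat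 x))\le k\,d_X(x,\hat x)$ for all $x,\hat x\in X$; a bi-Lipschitz embedding is a bi-Lipschitz homeomorphism onto its image.
   Formalization: The conclusion is α = β or α = −β in ℝ/ℤ instead of α = β: the reflection θ ↦ −θ induces an isometry of C_α onto C_{−α}, so α = β fails when β = −α. *)

theory Defs
  imports "HOL-Analysis.Analysis" "HOL-Algebra.Coset" "HOL-Algebra.Bij"
    "HOL-Algebra.Generated_Groups"
begin

section \<open>The upper half-space\<close>

text \<open>
  The point with coordinates \<open>(r, \<theta>, z, t)\<close> is encoded as \<open>(w, z, t)\<close> with
  \<open>w = r * cis (2 * pi * \<theta>)\<close>. The norm on this product type is the Euclidean one, so
  \<open>dist\<close> below is the Euclidean distance of four-space.
\<close>

type_synonym point = "complex \<times> real \<times> real"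

definition H4 :: "point set" where
  "H4 = {(w, z, t). t > 0}"

definition height :: "point \<Rightarrow> real" where
  "height x = snd (snd x)"

definition hyp_dist :: "point \<Rightarrow> point \<Rightarrow> real" where
  "hyp_dist x y = arcosh (1 + (dist x y)\<^sup>2 / (2 * height x * height y))"


section \<open>The Margulis constant\<close>

definition isometry_H4 :: "(point \<Rightarrow> point) set" where
  "isometry_H4 = {f \<in> Bij H4. \<forall>x\<in>H4. \<forall>y\<in>H4. hyp_dist (f x) (f y) = hyp_dist x y}"

text \<open>
  Discreteness is meant in the compact-open topology on isometries: the identity is
  isolated in the group.
\<close>

definition discrete_isometry_group :: "(point \<Rightarrow> point) set \<Rightarrow> bool" where
  "discrete_isometry_group \<Gamma> \<longleftrightarrow>
     subgroup \<Gamma> (BijGroup H4) \<and> \<Gamma> \<subseteq> isometry_H4 \<and>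
     (\<exists>K d. compact K \<and> K \<subseteq> H4 \<and> d > 0 \<and>
        (\<forall>\<gamma>\<in>\<Gamma>. (\<forall>x\<in>K. hyp_dist (\<gamma> x) x < d) \<longrightarrow> \<gamma> = \<one>\<^bsub>BijGroup H4\<^esub>))"

fun lower_central :: "('a, 'b) monoid_scheme \<Rightarrow> 'a set \<Rightarrow> nat \<Rightarrow> 'a set" where
  "lower_central G H 0 = H"
| "lower_central G H (Suc n) =
     generate G {x \<otimes>\<^bsub>G\<^esub> y \<otimes>\<^bsub>G\<^esub> inv\<^bsub>G\<^esub> x \<otimes>\<^bsub>G\<^esub> inv\<^bsub>G\<^esub> y | x y. x \<in> H \<and> y \<in> lower_central G H n}"

definition virtually_nilpotent :: "('a, 'b) monoid_scheme \<Rightarrow> 'a set \<Rightarrow> bool" where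
  "virtually_nilpotent G H \<longleftrightarrow>
     (\<exists>N. subgroup N G \<and> N \<subseteq> H \<and> finite (rcosets\<^bsub>G\<lparr>carrier := H\<rparr>\<^esub> N) \<and>
          (\<exists>n. lower_central G N n = {\<one>\<^bsub>G\<^esub>}))"

definition margulis_constant :: real where
  "margulis_constant = Sup {e. e > 0 \<and>
     (\<forall>\<Gamma>. discrete_isometry_group \<Gamma> \<longrightarrow>
        (\<forall>x\<in>H4. virtually_nilpotent (BijGroup H4)
           (generate (BijGroup H4) {\<gamma> \<in> \<Gamma>. hyp_dist (\<gamma> x) x < e})))}"


section \<open>Margulis regions and cusps\<close>

text \<open>
  An angle in \<open>\<real> / \<int>\<close> is represented by a real number. Everything below depends only on
  that number modulo the integers.
\<close>

definition screw :: "real \<Rightarrow> point \<Rightarrow> point" where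
  "screw \<alpha> = (\<lambda>(w, z, t). (cis (2 * pi * \<alpha>) * w, z + 1, t))"

definition margulis_region :: "real \<Rightarrow> real \<Rightarrow> point set" where
  "margulis_region \<epsilon> \<alpha> =
     (\<Union>j\<in>{1..}. {x \<in> H4. hyp_dist ((screw \<alpha> ^^ j) x) x < \<epsilon>})"

definition orbit_rel :: "real \<Rightarrow> real \<Rightarrow> (point \<times> point) set" where
  "orbit_rel \<epsilon> \<alpha> = {(x, y) \<in> margulis_region \<epsilon> \<alpha> \<times> margulis_region \<epsilon> \<alpha>.
     \<exists>j::nat. y = (screw \<alpha> ^^ j) x \<or> x = (screw \<alpha> ^^ j) y}"

definition margulis_cusp :: "real \<Rightarrow> real \<Rightarrow> point set set" where
  "margulis_cusp \<epsilon> \<alpha> = margulis_region \<epsilon> \<alpha> // orbit_rel \<epsilon> \<alpha>"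

text \<open>The quotient metric: the hyperbolic distance between two orbits.\<close>

definition cusp_dist :: "point set \<Rightarrow> point set \<Rightarrow> real" where
  "cusp_dist A B = Inf {hyp_dist x y | x y. x \<in> A \<and> y \<in> B}"

text \<open>
  For metrics \<open>dX\<close> and \<open>dY\<close> the two inequalities make \<open>\<phi>\<close> a homeomorphism onto its image.
\<close>

definition bilipschitz_embedding ::
  "'a set \<Rightarrow> ('a \<Rightarrow> 'a \<Rightarrow> real) \<Rightarrow> 'b set \<Rightarrow> ('b \<Rightarrow> 'b \<Rightarrow> real) \<Rightarrow> ('a \<Rightarrow> 'b) \<Rightarrow> bool" where
  "bilipschitz_embedding X dX Y dY \<phi> \<longleftrightarrow> \<phi> ` X \<subseteq> Y \<and>
     (\<exists>k\<ge>1. \<forall>x\<in>X. \<forall>x'\<in>X. inverse k * dX x x' \<le> dY (\<phi> x) (\<phi> x') \<and>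
                            dY (\<phi> x) (\<phi> x') \<le> k * dX x x')"


section \<open>Cusps of opposite angles are isometric\<close>

text \<open>
  The reflection \<open>\<theta> \<mapsto> -\<theta>\<close> conjugates \<open>screw \<alpha>\<close> to \<open>screw (-\<alpha>)\<close>. Since bi-Lipschitz
  embeddings are not required to preserve orientation, they determine the angle of a cusp
  at most up to sign.
\<close>

definition reflect :: "point \<Rightarrow> point" where
  "reflect = (\<lambda>(w, z, t). (cnj w, z, t))"

lemma reflect_reflect [simp]: "reflect (reflect x) = x"
  by (cases x) (auto simp: reflect_def)

lemma reflect_H4 [simp]: "reflect x \<in> H4 \<longleftrightarrow> x \<in> H4"
  by (cases x) (auto simp: reflect_def H4_def)

lemma hyp_dist_reflect [simp]: "hyp_dist (reflect x) (reflect y) = hyp_dist x y"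
proof -
  have "dist (cnj a) (cnj b) = dist a b" for a b
    by (metis complex_cnj_diff complex_mod_cnj dist_norm)
  then show ?thesis
    by (cases x; cases y) (auto simp: hyp_dist_def height_def reflect_def dist_prod_def)
qed

lemma screw_reflect: "screw (-\<alpha>) (reflect x) = reflect (screw \<alpha> x)"
  by (cases x) (auto simp: screw_def reflect_def cis_cnj)

lemma screw_pow_reflect: "(screw (-\<alpha>) ^^ j) (reflect x) = reflect ((screw \<alpha> ^^ j) x)"
  by (induction j) (auto simp: screw_reflect)

lemma reflect_region: "reflect x \<in> margulis_region \<epsilon> (-\<alpha>) \<longleftrightarrow> x \<in> margulis_region \<epsilon> \<alpha>"
  by (auto simp: margulis_region_def screw_pow_reflect)

lemma reflect_orbit_rel: "(reflect x, reflect y) \<in> orbit_rel \<epsilon> (-\<alpha>) \<longleftrightarrow> (x, y) \<in> orbit_rel \<epsilon> \<alpha>"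
  by (auto simp: orbit_rel_def reflect_region screw_pow_reflect)
    (metis reflect_reflect)+

lemma reflect_orbit: "reflect ` (orbit_rel \<epsilon> \<alpha> `` {x}) = orbit_rel \<epsilon> (-\<alpha>) `` {reflect x}"
proof (intro equalityI subsetI)
  fix y assume "y \<in> orbit_rel \<epsilon> (-\<alpha>) `` {reflect x}"
  then have "(reflect x, reflect (reflect y)) \<in> orbit_rel \<epsilon> (-\<alpha>)" by simp
  then have "reflect y \<in> orbit_rel \<epsilon> \<alpha> `` {x}" by (simp only: reflect_orbit_rel Image_singleton_iff)
  then show "y \<in> reflect ` (orbit_rel \<epsilon> \<alpha> `` {x})" by (metis imageI reflect_reflect)
qed (auto simp: reflect_orbit_rel)

lemma cusp_dist_reflect: "cusp_dist (reflect ` A) (reflect ` B) = cusp_dist A B"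
proof -
  have "{hyp_dist x y | x y. x \<in> reflect ` A \<and> y \<in> reflect ` B} =
        {hyp_dist (reflect x) (reflect y) | x y. x \<in> A \<and> y \<in> B}"
    by blast
  then show ?thesis by (simp add: cusp_dist_def)
qed

lemma cusp_reflect: "(`) reflect ` margulis_cusp \<epsilon> \<alpha> \<subseteq> margulis_cusp \<epsilon> (-\<alpha>)"
  by (auto simp: margulis_cusp_def reflect_orbit reflect_region elim!: quotientE intro!: quotientI)

lemma bilipschitz_embedding_opposite_angle:
  "\<exists>\<phi>. bilipschitz_embedding (margulis_cusp \<epsilon> \<alpha>) cusp_dist (margulis_cusp \<epsilon> (-\<alpha>)) cusp_dist \<phi>"
  by (rule exI[of _ "(`) reflect"], unfold bilipschitz_embedding_def)
    (intro conjI exI[of _ 1] cusp_reflect, auto simp: cusp_dist_reflect)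

end

theory Submission
  imports Defs
begin

text \<open>
  A bi-Lipschitz embedding of cusps is studied through its lift to the half-space. The lift
  \<open>\<Phi>\<close> intertwines the screw translation of angle \<open>\<alpha>\<close> with the \<open>n\<close>-th power of the screw
  translation of angle \<open>\<beta>\<close>, for some integer \<open>n\<close>. Although the angles are invisible in the
  size of the two cusps up to bounded factors, the lift compares individual powers: at a point
  \<open>(w, z, t)\<close> with \<open>\<bar>w\<bar>\<close> comparable with \<open>t\<close> and \<open>t\<close> very large, the \<open>j\<close>-th power of the screw
  moves by about the distance \<open>\<parallel>j \<alpha>\<parallel>\<close> of \<open>j \<alpha>\<close> to the integers, because its translation part is
  negligible. So \<open>\<parallel>j \<alpha>\<parallel>\<close> and \<open>\<parallel>j n \<beta>\<parallel>\<close> agree up to a bounded factor, uniformly in \<open>j\<close>. Once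
  \<open>n = \<plusminus>1\<close> is known, \<open>j \<alpha> \<mapsto> j \<beta>\<close> is a bicontinuous correspondence of dense subgroups of the
  circle, hence comes from an automorphism of the circle, which is \<open>\<plusminus>1\<close>
  (\<open>comparable_rotations_imp_eq\<close>).

  The lift is constructed over a cone \<open>t > a * \<bar>w\<bar> + b\<close>, which for every slope \<open>a > 0\<close> lies in the
  Margulis region if \<open>b\<close> is large (\<open>axis_cone_subset_margulis_region\<close>). The cone is convex, so
  that a continuous logarithm of the circle coordinate of the quotient suffices
  (\<open>lift_quotient_map\<close>), and small slopes provide hyperbolic balls of any prescribed radius
  around the high points of the axis.

  The topological input is invariance of domain. It shows that the image of the cone contains a
  ball of radius \<open>L\<close> around \<open>\<Phi> x\<close> as soon as the cone contains the ball of radius \<open>k * L\<close> around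
  \<open>x\<close>, where \<open>k\<close> is the Lipschitz constant (\<open>ball_subset_image\<close>). This has three uses. As
  \<open>\<Phi> x\<close> lies in the Margulis region, some power of the screw moves it by less than
  \<open>\<epsilon> \<le> L\<close> and hence within the image, which is impossible for \<open>n = 0\<close> (\<open>n_nonzero\<close>). Then
  \<open>\<Phi>\<close> maps the upper part of the axis close to the axis, where the screw itself moves points by
  very little, again within the image, so that \<open>n\<close> divides one (\<open>abs_n_eq_1\<close>). Finally
  the covered balls allow the inverse of \<open>\<Phi>\<close> to be integrated along segments, which gives the
  comparison of displacements in both directions (\<open>rotation_size_image_le\<close>,
  \<open>rotation_size_le_image\<close>).
\<close>

section \<open>Distances in the upper half-space\<close>

lemma height_simp [simp]: "height (w, z, t) = t"
  by (simp add: height_def)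

lemma mem_H4_iff: "x \<in> H4 \<longleftrightarrow> 0 < height x"
  by (cases x) (auto simp: H4_def)

lemma continuous_on_height [continuous_intros]:
  "continuous_on S f \<Longrightarrow> continuous_on S (\<lambda>x. height (f x))"
  unfolding height_def by (intro continuous_intros)

lemma dist_components_le:
  fixes x y :: point
  shows "cmod (fst x - fst y) \<le> dist x y" "\<bar>fst (snd x) - fst (snd y)\<bar> \<le> dist x y"
    "\<bar>height x - height y\<bar> \<le> dist x y"
  using dist_fst_le[of x y] dist_snd_le[of x y]
    dist_fst_le[of "snd x" "snd y"] dist_snd_le[of "snd x" "snd y"]
  by (auto simp: height_def dist_norm)

lemma dist_point_sq:
  "(dist (w, z, t) (w', z', t'))\<^sup>2 = (cmod (w - w'))\<^sup>2 + (z - z')\<^sup>2 + (t - t')\<^sup>2"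
  for z z' t t' :: real
  by (simp add: dist_prod_def dist_norm)

lemma dist_horizontal_le:
  "dist (w, z, t) (w', z', t :: real) \<le> cmod (w - w') + \<bar>z - z'\<bar>" for z z' :: real
proof -
  have "dist (w, z, t) (w', z', t) = sqrt ((cmod (w - w'))\<^sup>2 + \<bar>z - z'\<bar>\<^sup>2)"
    by (simp add: dist_prod_def dist_norm)
  also have "\<dots> \<le> cmod (w - w') + \<bar>z - z'\<bar>"
    by (intro real_le_lsqrt) (auto simp: power2_sum)
  finally show ?thesis .
qed

text \<open>
  All estimates with the hyperbolic distance go through this polynomial inequality, which
  compares it with the Euclidean distance at the scale of the heights.
\<close>

lemma hyp_dist_less_iff:
  assumes "x \<in> H4" "y \<in> H4"
  shows "hyp_dist x y < e \<longleftrightarrow> 0 < e \<and> (dist x y)\<^sup>2 < 2 * height x * height y * (cosh e - 1)"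
proof -
  define q where "q = 1 + (dist x y)\<^sup>2 / (2 * height x * height y)"
  have pos: "0 < 2 * height x * height y"
    using assms by (simp add: mem_H4_iff)
  then have q: "1 \<le> q"
    by (simp add: q_def)
  have "arcosh q < e \<longleftrightarrow> 0 < e \<and> q < cosh e"
  proof (cases "0 < e")
    case True
    then have "arcosh q < e \<longleftrightarrow> arcosh q < arcosh (cosh e)"
      by (simp add: arcosh_cosh_real)
    then show ?thesis
      using True q cosh_real_ge_1[of e] by simp
  qed (use arcosh_nonneg_real[OF q] in linarith)
  moreover have "q < cosh e \<longleftrightarrow> (dist x y)\<^sup>2 < 2 * height x * height y * (cosh e - 1)"
    using pos pos_divide_less_eq[OF pos, of "(dist x y)\<^sup>2" "cosh e - 1"]
    by (simp add: q_def mult.commute[of "cosh e - 1"] add.commute less_diff_eq)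
  ultimately show ?thesis
    by (simp add: hyp_dist_def q_def)
qed

lemma hyp_dist_nonneg: "x \<in> H4 \<Longrightarrow> y \<in> H4 \<Longrightarrow> 0 \<le> hyp_dist x y"
  using hyp_dist_less_iff[of x y "hyp_dist x y"] hyp_dist_less_iff[of x y 0] by auto

lemma hyp_dist_self [simp]: "hyp_dist x x = 0"
  by (simp add: hyp_dist_def)

lemma hyp_dist_sym: "hyp_dist x y = hyp_dist y x"
  by (simp add: hyp_dist_def dist_commute mult.commute mult.left_commute)

lemma dist_sq_eq_cosh:
  assumes "x \<in> H4" "y \<in> H4"
  shows "(dist x y)\<^sup>2 = 2 * height x * height y * (cosh (hyp_dist x y) - 1)"
proof -
  have "0 < height x" "0 < height y"
    using assms by (auto simp: mem_H4_iff)
  then show ?thesis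
    by (simp add: hyp_dist_def)
qed

lemma height_ratio_le:
  assumes "x \<in> H4" "y \<in> H4" and d: "(dist x y)\<^sup>2 \<le> 2 * height x * height y * (C - 1)"
  shows "height y \<le> 2 * C * height x"
proof -
  have t: "0 < height x" "0 < height y"
    using assms by (auto simp: mem_H4_iff)
  have "(height x - height y)\<^sup>2 \<le> (dist x y)\<^sup>2"
    using dist_components_le(3)[of x y] by (metis abs_ge_zero power2_abs power_mono)
  then have "height y * height y \<le> 2 * C * height x * height y - (height x)\<^sup>2"
    using d by (simp add: power2_eq_square algebra_simps)
  then have "height y * height y \<le> (2 * C * height x) * height y"
    by (smt (verit) zero_le_power2)
  then show ?thesis
    using t(2) by (rule mult_right_le_imp_le)
qed

lemma dist_le_height:
  assumes "x \<in> H4" "y \<in> H4" "1 \<le> C" and d: "(dist x y)\<^sup>2 \<le> 2 * height x * height y * (C - 1)"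
  shows "dist x y \<le> 2 * C * height x"
proof -
  have "0 < height x"
    using assms by (auto simp: mem_H4_iff)
  have "(dist x y)\<^sup>2 \<le> (2 * height x * (C - 1)) * height y"
    using d by (simp add: mult_ac)
  also have "\<dots> \<le> (2 * height x * (C - 1)) * (2 * C * height x)"
    using \<open>0 < height x\<close> assms(3) height_ratio_le[OF assms(1,2) d] by (intro mult_left_mono) auto
  also have "\<dots> \<le> (2 * C * height x)\<^sup>2"
    using \<open>0 < height x\<close> assms(3) by (simp add: power2_eq_square algebra_simps)
  finally show ?thesis
    by (rule power2_le_imp_le) (use \<open>0 < height x\<close> assms(3) in auto)
qed

definition hyp_ball :: "point \<Rightarrow> real \<Rightarrow> point set" where
  "hyp_ball x r = {y \<in> H4. hyp_dist x y < r}"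

text \<open>
  A hyperbolic ball is also a Euclidean ball, with another centre: after completing the
  square, the defining inequality bounds the Euclidean distance to a fixed point. By convexity,
  balls are connected and horizontal segments between their points stay inside.
\<close>

lemma convex_hyp_ball:
  assumes "x \<in> H4"
  shows "convex (hyp_ball x r)"
proof (cases "0 < r")
  case True
  have tx: "0 < height x"
    using assms by (simp add: mem_H4_iff)
  define c :: point where "c = x + (0, 0, height x * (cosh r - 1))"
  define q where "q = (height x)\<^sup>2 * ((cosh r)\<^sup>2 - 1)"
  have sq: "(dist x y)\<^sup>2 - 2 * height x * height y * (cosh r - 1) = (dist c y)\<^sup>2 - q" for y
    by (cases x; cases y) (simp add: c_def q_def dist_point_sq, simp add: power2_eq_square algebra_simps)
  have "hyp_ball x r = {y. dist c y < sqrt q}"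
  proof (rule Set.set_eqI)
    fix y
    have "y \<in> hyp_ball x r \<longleftrightarrow> (dist x y)\<^sup>2 < 2 * height x * height y * (cosh r - 1)"
    proof
      assume *: "(dist x y)\<^sup>2 < 2 * height x * height y * (cosh r - 1)"
      have "0 < 2 * height x * (cosh r - 1)"
        using tx True cosh_real_nonneg_less_iff[of 0 r] by simp
      moreover have "0 < 2 * height x * (cosh r - 1) * height y"
        using le_less_trans[OF zero_le_power2 *] by (simp add: mult_ac)
      ultimately have "0 < height y"
        by (rule zero_less_mult_pos[rotated])
      then show "y \<in> hyp_ball x r"
        using * True assms by (simp add: hyp_ball_def hyp_dist_less_iff mem_H4_iff)
    qed (use assms in \<open>auto simp: hyp_ball_def hyp_dist_less_iff\<close>)
    also have "\<dots> \<longleftrightarrow> (dist c y)\<^sup>2 < q"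
      using sq[of y] by linarith
    also have "\<dots> \<longleftrightarrow> dist c y < sqrt q"
      by (metis real_less_rsqrt real_sqrt_abs real_sqrt_less_iff abs_of_nonneg zero_le_dist)
    finally show "y \<in> hyp_ball x r \<longleftrightarrow> y \<in> {y. dist c y < sqrt q}"
      by simp
  qed
  then show ?thesis
    using convex_ball[of c "sqrt q"] by (simp add: ball_def)
next
  case False
  have "\<not> hyp_dist x y < r" if "y \<in> H4" for y
    using hyp_dist_nonneg[OF assms that] False by linarith
  then have "hyp_ball x r = {}"
    by (auto simp: hyp_ball_def)
  then show ?thesis
    by simp
qed

text \<open>
  The bounds \<open>u\<^sup>2 / 2 \<le> cosh u - 1 \<le> u\<^sup>2\<close> say that at small scale the hyperbolic distance is the
  Euclidean distance divided by the height, up to a factor.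
\<close>

lemma cosh_minus_one_ge: "u\<^sup>2 / 2 \<le> cosh u - 1" for u :: real
proof -
  have *: "v \<le> sinh v" if "0 \<le> v" for v :: real
  proof -
    have "sinh 0 - 0 \<le> sinh v - v"
    proof (rule DERIV_nonneg_imp_nondecreasing[OF that])
      show "\<exists>y. ((\<lambda>v. sinh v - v) has_real_derivative y) (at x) \<and> 0 \<le> y" for x :: real
        using cosh_real_ge_1[of x]
        by (intro exI[of _ "cosh x - 1"]) (auto intro!: derivative_eq_intros)
    qed
    then show ?thesis
      by simp
  qed
  have "cosh u - 1 = 2 * (sinh (\<bar>u\<bar> / 2))\<^sup>2"
    using cosh_double_cosh[of "\<bar>u\<bar> / 2"] by (simp add: sinh_square_eq algebra_simps)
  moreover have "(\<bar>u\<bar> / 2)\<^sup>2 \<le> (sinh (\<bar>u\<bar> / 2))\<^sup>2"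
    by (intro power_mono *) auto
  ultimately show ?thesis
    by (simp add: power_divide)
qed

lemma cosh_minus_one_le: "cosh u - 1 \<le> u\<^sup>2" if "0 \<le> u" "u \<le> 1" for u :: real
proof -
  have "exp (- u) \<le> 1 - u + u\<^sup>2"
  proof -
    have "1 \<le> (1 - u + u\<^sup>2) * (1 + u)"
      using that by (simp add: power2_eq_square algebra_simps)
    also have "\<dots> \<le> (1 - u + u\<^sup>2) * exp u"
    proof (rule mult_left_mono)
      show "0 \<le> 1 - u + u\<^sup>2" using that by simp
    qed simp
    finally show ?thesis
      by (simp add: exp_minus field_simps)
  qed
  then show ?thesis
    using exp_bound[OF that] by (simp add: cosh_field_def field_simps)
qed

section \<open>Integer powers of a screw translation\<close>

definition screw_power :: "real \<Rightarrow> int \<Rightarrow> point \<Rightarrow> point" where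
  "screw_power \<gamma> j = (\<lambda>(w, z, t). (cis (2 * pi * \<gamma> * j) * w, z + j, t))"

lemma screw_power_simp:
  "screw_power \<gamma> j (w, z, t) = (cis (2 * pi * \<gamma> * j) * w, z + j, t)"
  by (simp add: screw_power_def)

lemma screw_funpow: "(screw \<gamma> ^^ j) x = screw_power \<gamma> (int j) x"
  by (induction j; cases x) (auto simp: screw_power_def screw_def cis_mult algebra_simps
      split: prod.splits)

lemma screw_power_0 [simp]: "screw_power \<gamma> 0 x = x"
  by (cases x) (simp add: screw_power_simp)

lemma screw_power_screw_power [simp]:
  "screw_power \<gamma> i (screw_power \<gamma> j x) = screw_power \<gamma> (i + j) x"
proof (cases x)
  case (fields w z t)
  have "cis (2 * pi * \<gamma> * i) * (cis (2 * pi * \<gamma> * j) * w) = cis (2 * pi * \<gamma> * (i + j)) * w"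
    by (simp add: cis_mult distrib_left flip: mult.assoc)
  then show ?thesis
    by (simp add: fields screw_power_simp)
qed

lemma height_screw_power [simp]: "height (screw_power \<gamma> j x) = height x"
  by (cases x) (simp add: screw_power_simp)

lemma norm_fst_screw_power [simp]: "cmod (fst (screw_power \<gamma> j x)) = cmod (fst x)"
  by (cases x) (simp add: screw_power_simp norm_mult)

lemma fst_snd_screw_power [simp]: "fst (snd (screw_power \<gamma> j x)) = fst (snd x) + j"
  by (cases x) (simp add: screw_power_simp)

lemma screw_power_mem_H4 [simp]: "screw_power \<gamma> j x \<in> H4 \<longleftrightarrow> x \<in> H4"
  by (simp add: mem_H4_iff)

lemma screw_power_eq_iff [simp]: "screw_power \<gamma> i x = screw_power \<gamma> j x \<longleftrightarrow> i = j"
  by (cases x) (auto simp: screw_power_simp)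

lemma dist_screw_power [simp]: "dist (screw_power \<gamma> j x) (screw_power \<gamma> j y) = dist x y"
proof -
  have "cmod (cis a * w - cis a * w') = cmod (w - w')" for a w w'
    by (metis mult_1 norm_cis norm_mult right_diff_distrib)
  then show ?thesis
    by (cases x; cases y) (simp add: screw_power_simp dist_prod_def dist_norm)
qed

lemma hyp_dist_screw_power [simp]:
  "hyp_dist (screw_power \<gamma> j x) (screw_power \<gamma> j y) = hyp_dist x y"
  by (simp add: hyp_dist_def)

lemma hyp_dist_screw_power_left:
  "hyp_dist (screw_power \<gamma> i x) (screw_power \<gamma> j y) = hyp_dist x (screw_power \<gamma> (j - i) y)"
  using hyp_dist_screw_power[of \<gamma> i x "screw_power \<gamma> (j - i) y"] by simp

lemma continuous_on_screw_power: "continuous_on S (screw_power \<gamma> j)"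
  unfolding screw_power_def case_prod_unfold by (intro continuous_intros)

lemma open_screw_power_image: "open U \<Longrightarrow> open (screw_power \<gamma> j ` U)"
proof -
  assume "open U"
  have "screw_power \<gamma> j ` U = screw_power \<gamma> (- j) -` U"
  proof (intro equalityI subsetI)
    fix x assume "x \<in> screw_power \<gamma> (- j) -` U"
    then show "x \<in> screw_power \<gamma> j ` U"
      by (intro image_eqI[of _ _ "screw_power \<gamma> (- j) x"]) auto
  qed auto
  then show ?thesis
    using \<open>open U\<close> continuous_on_screw_power by (simp add: open_vimage)
qed

text \<open>
  How far the rotation by \<open>x\<close> full turns moves the unit circle. It is comparable with the
  distance from \<open>x\<close> to the nearest integer.
\<close>

definition rotation_size :: "real \<Rightarrow> real" where
  "rotation_size x = cmod (cis (2 * pi * x) - 1)"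

lemma rotation_size_nonneg [simp]: "0 \<le> rotation_size x"
  by (simp add: rotation_size_def)

lemma rotation_size_le_2: "rotation_size x \<le> 2"
  using norm_triangle_ineq4[of "cis (2 * pi * x)" 1] by (simp add: rotation_size_def)

lemma rotation_size_minus [simp]: "rotation_size (- x) = rotation_size x"
proof -
  have "cnj (cis (2 * pi * x) - 1) = cis (2 * pi * (- x)) - 1"
    by (simp add: cis_cnj)
  then show ?thesis
    unfolding rotation_size_def by (metis complex_mod_cnj)
qed

lemma displacement_fst:
  "cmod (fst x - fst (screw_power \<gamma> j x)) = rotation_size (\<gamma> * j) * cmod (fst x)"
proof (cases x)
  case (fields w z t)
  have "w - cis (2 * pi * \<gamma> * j) * w = - ((cis (2 * pi * (\<gamma> * j)) - 1) * w)"
    by (simp add: algebra_simps)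
  then show ?thesis
    unfolding fields by (simp add: screw_power_simp rotation_size_def norm_mult)
qed

lemma displacement_ge_rotation:
  "rotation_size (\<gamma> * j) * cmod (fst x) \<le> dist x (screw_power \<gamma> j x)"
  using dist_components_le(1)[of x "screw_power \<gamma> j x"] by (simp add: displacement_fst)

lemma displacement_ge_int: "\<bar>real_of_int j\<bar> \<le> dist x (screw_power \<gamma> j x)"
  using dist_components_le(2)[of x "screw_power \<gamma> j x"] by simp

lemma displacement_le:
  "dist x (screw_power \<gamma> j x) \<le> \<bar>real_of_int j\<bar> + rotation_size (\<gamma> * j) * cmod (fst x)"
proof (cases x)
  case (fields w z t)
  show ?thesis
    using displacement_fst[of x \<gamma> j] dist_horizontal_le[of w z t "cis (2 * pi * \<gamma> * j) * w" "z + j"]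
    by (simp add: fields screw_power_simp)
qed

section \<open>Lipschitz maps modulo screw translations\<close>

text \<open>
  A map that is Lipschitz for the quotient metric is Lipschitz at small scale: the
  translation part of a nontrivial power of the screw moves every point of bounded height
  by a definite amount, so for nearby points only the trivial power can realise a small
  quotient distance. The conclusion is stated in Euclidean terms, which makes it possible to
  integrate it along segments without a triangle inequality for the hyperbolic distance.
\<close>

lemma quotient_lipschitz_imp_local:
  fixes f :: "point \<Rightarrow> point"
  assumes A: "A \<subseteq> H4" "f ` A \<subseteq> H4" and cont: "continuous_on A f" and k: "1 \<le> k"
    and lip: "\<And>x x' e. \<lbrakk>x \<in> A; x' \<in> A; hyp_dist x x' < e\<rbrakk>
      \<Longrightarrow> \<exists>j. hyp_dist (f x) (screw_power \<gamma> j (f x')) < k * e"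
    and x: "x \<in> A"
  shows "\<exists>d>0. \<forall>x'\<in>A. dist x x' < d \<longrightarrow>
    dist (f x) (f x') \<le> 2 * k * (height (f x) / height x) * dist x x'"
proof -
  define t where "t = height x"
  define \<tau> where "\<tau> = height (f x)"
  have t: "0 < t" and \<tau>: "0 < \<tau>"
    using A x by (auto simp: t_def \<tau>_def mem_H4_iff)
  \<comment> \<open>points of comparable height within hyperbolic distance \<open>c\<close> of \<open>f x\<close> are within
    Euclidean distance \<open>1 / 2\<close>\<close>
  define c where "c = min 1 (1 / (5 * \<tau>))"
  have c: "0 < c" "c \<le> 1" "c * (5 * \<tau>) \<le> 1"
    using \<tau> by (auto simp: c_def min_def field_simps)
  have "0 < min (1/2) (\<tau> / 4)"
    using \<tau> by simp
  then obtain d1 where d1: "0 < d1" "\<And>x'. x' \<in> A \<Longrightarrow> dist x x' < d1 \<Longrightarrow> dist (f x) (f x') < min (1/2) (\<tau> / 4)"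
    using cont x unfolding continuous_on_iff by (metis dist_commute)
  define d where "d = min d1 (min (t / 4) (t * c / (2 * k)))"
  have "0 < d"
    using d1(1) t c(1) k by (simp add: d_def)
  moreover have "dist (f x) (f x') \<le> 2 * k * (\<tau> / t) * dist x x'" if x': "x' \<in> A" and near: "dist x x' < d" for x'
  proof -
    define t' where "t' = height x'"
    define \<tau>' where "\<tau>' = height (f x')"
    define \<rho> where "\<rho> = hyp_dist x x'"
    define h where "h = hyp_dist (f x) (f x')"
    have H: "x \<in> H4" "x' \<in> H4" "f x \<in> H4" "f x' \<in> H4"
      using A x x' by auto
    have \<rho>0: "0 \<le> \<rho>" "0 \<le> h"
      using H by (auto simp: \<rho>_def h_def hyp_dist_nonneg)
    have t': "3/4 * t \<le> t'"
    proof -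
      have "dist x x' < t / 4"
        using near by (simp add: d_def)
      then show ?thesis
        using dist_components_le(3)[of x x'] unfolding t_def t'_def by linarith
    qed
    have fnear: "dist (f x) (f x') < min (1/2) (\<tau> / 4)"
      using d1(2)[OF x'] near by (simp add: d_def)
    then have \<tau>': "\<tau>' \<le> 5/4 * \<tau>" "0 < \<tau>'"
      using dist_components_le(3)[of "f x" "f x'"] \<tau> by (auto simp: \<tau>_def \<tau>'_def)
    have "\<rho> < c / k"
    proof -
      have "(dist x x')\<^sup>2 < (t * c / (2 * k))\<^sup>2"
        using near by (intro power_strict_mono) (auto simp: d_def)
      also have "\<dots> = t\<^sup>2 * (c / k)\<^sup>2 / 4"
        by (simp add: power_mult_distrib power_divide)
      also have "\<dots> \<le> 3/4 * (t\<^sup>2 * (c / k)\<^sup>2)"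
        by simp
      also have "\<dots> = 2 * t * (3/4 * t) * ((c / k)\<^sup>2 / 2)"
        by (simp add: power2_eq_square[of t])
      also have "\<dots> \<le> 2 * t * t' * (cosh (c / k) - 1)"
        using t t' cosh_minus_one_ge[of "c / k"] by (intro mult_mono) auto
      finally show ?thesis
        using H c(1) k by (simp add: \<rho>_def hyp_dist_less_iff t_def t'_def)
    qed
    have below: "h < k * e" if e: "\<rho> < e" "e < c / k" for e
    proof -
      obtain j where j: "hyp_dist (f x) (screw_power \<gamma> j (f x')) < k * e"
        using lip[OF x x'] e(1) by (auto simp: \<rho>_def)
      also have "k * e < c"
        using e(2) k by (simp add: field_simps)
      finally have "(dist (f x) (screw_power \<gamma> j (f x')))\<^sup>2 < 2 * \<tau> * \<tau>' * (cosh c - 1)"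
        using H by (simp add: hyp_dist_less_iff \<tau>_def \<tau>'_def)
      also have "\<dots> \<le> 2 * \<tau> * (5/4 * \<tau>) * c\<^sup>2"
        using \<tau> \<tau>' c cosh_minus_one_le[of c] cosh_real_ge_1[of c] by (intro mult_mono) auto
      also have "\<dots> = (c * (5 * \<tau>))\<^sup>2 / 10"
        by (simp add: power2_eq_square)
      also have "\<dots> \<le> 1 / 10"
        using c \<tau> power_le_one[of "c * (5 * \<tau>)" 2] by simp
      also have "\<dots> \<le> (1/2)\<^sup>2"
        by (simp add: power2_eq_square)
      finally have "dist (f x) (screw_power \<gamma> j (f x')) < 1/2"
        by (rule power2_less_imp_less) simp
      then have "\<bar>real_of_int j\<bar> < 1"
        using dist_components_le(2)[of "f x" "screw_power \<gamma> j (f x')"]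
          dist_components_le(2)[of "f x" "f x'"] fnear
        unfolding fst_snd_screw_power min_less_iff_conj by linarith
      then have "j = 0"
        by linarith
      then show ?thesis
        using j by (simp add: h_def)
    qed
    have hk: "h \<le> k * \<rho>"
    proof (rule ccontr)
      assume "\<not> h \<le> k * \<rho>"
      then have "\<rho> < h / k"
        using k by (simp add: field_simps)
      then obtain e where "\<rho> < e" "e < min (h / k) (c / k)"
        using \<open>\<rho> < c / k\<close> dense[of \<rho> "min (h / k) (c / k)"] by auto
      then show False
        using below[of e] k by (simp add: field_simps)
    qed
    have small: "k * \<rho> \<le> 1"
      using \<open>\<rho> < c / k\<close> c(2) k by (simp add: field_simps)
    have "(dist (f x) (f x'))\<^sup>2 = 2 * \<tau> * \<tau>' * (cosh h - 1)"
      using dist_sq_eq_cosh[OF H(3,4)] by (simp add: \<tau>_def \<tau>'_def h_def)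
    also have "\<dots> \<le> 2 * \<tau> * \<tau>' * (cosh (k * \<rho>) - 1)"
      using \<tau> \<tau>' hk \<rho>0 k by (intro mult_left_mono) (auto simp: cosh_real_nonneg_le_iff)
    also have "\<dots> \<le> 2 * \<tau> * \<tau>' * (k * \<rho>)\<^sup>2"
      using \<tau> \<tau>' small \<rho>0 k by (intro mult_left_mono cosh_minus_one_le) auto
    finally have 1: "(dist (f x) (f x'))\<^sup>2 \<le> 2 * \<tau> * \<tau>' * (k * \<rho>)\<^sup>2" .
    have "2 * t * t' * (\<rho>\<^sup>2 / 2) \<le> 2 * t * t' * (cosh \<rho> - 1)"
      using t t' by (intro mult_left_mono cosh_minus_one_ge) auto
    also have "\<dots> = (dist x x')\<^sup>2"
      using dist_sq_eq_cosh[OF H(1,2)] by (simp add: t_def t'_def \<rho>_def)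
    finally have 2: "t * t' * \<rho>\<^sup>2 \<le> (dist x x')\<^sup>2"
      by simp
    have "t\<^sup>2 * \<rho>\<^sup>2 * 3/4 \<le> t * t' * \<rho>\<^sup>2"
      using t mult_right_mono[OF t', of "t * \<rho>\<^sup>2"] by (simp add: power2_eq_square[of t] mult_ac)
    then have 3: "t\<^sup>2 * \<rho>\<^sup>2 * 3/4 \<le> (dist x x')\<^sup>2"
      using 2 by linarith
    have "2 * \<tau> * \<tau>' * (k * \<rho>)\<^sup>2 \<le> 2 * \<tau> * (5/4 * \<tau>) * (k * \<rho>)\<^sup>2"
      using \<tau> \<tau>' by (intro mult_right_mono mult_left_mono) auto
    then have "t\<^sup>2 * (dist (f x) (f x'))\<^sup>2 \<le> t\<^sup>2 * (5/2 * \<tau>\<^sup>2 * (k * \<rho>)\<^sup>2)"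
      using 1 by (intro mult_left_mono) (auto simp: power2_eq_square)
    also have "\<dots> = (10/3 * \<tau>\<^sup>2 * k\<^sup>2) * (t\<^sup>2 * \<rho>\<^sup>2 * 3/4)"
      by (simp add: power_mult_distrib)
    also have "\<dots> \<le> (10/3 * \<tau>\<^sup>2 * k\<^sup>2) * (dist x x')\<^sup>2"
      using 3 by (intro mult_left_mono) auto
    also have "\<dots> \<le> (4 * \<tau>\<^sup>2 * k\<^sup>2) * (dist x x')\<^sup>2"
      by (intro mult_right_mono) auto
    finally have "(t * dist (f x) (f x'))\<^sup>2 \<le> (2 * k * \<tau> * dist x x')\<^sup>2"
      by (simp add: power_mult_distrib mult_ac)
    then have "t * dist (f x) (f x') \<le> 2 * k * \<tau> * dist x x'"
      by (rule power2_le_imp_le) (use k \<tau> in auto)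
    then show ?thesis
      using t by (simp add: field_simps)
  qed
  ultimately show ?thesis
    unfolding t_def \<tau>_def by blast
qed

text \<open>
  Integrating the local estimate along a Euclidean segment: the logarithm of the height of
  the image changes at a bounded rate, which first controls the heights and then the
  Euclidean displacement. Here \<open>M\<close> bounds the hyperbolic length of the segment, times the
  Lipschitz constant.
\<close>

lemma local_lipschitz_along_segment:
  fixes f :: "point \<Rightarrow> point"
  assumes seg: "closed_segment u v \<subseteq> A" and A: "f ` A \<subseteq> H4"
    and loc: "\<And>x. x \<in> A \<Longrightarrow> \<exists>d>0. \<forall>x'\<in>A. dist x x' < d \<longrightarrow>
      dist (f x) (f x') \<le> \<kappa> * (height (f x) / height x) * dist x x'"
    and m: "0 < m" "\<And>p. p \<in> closed_segment u v \<Longrightarrow> m \<le> height p"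
    and \<kappa>: "0 \<le> \<kappa>" and M: "\<kappa> * dist u v / m \<le> M"
  shows "height (f v) \<le> exp (2 * M) * height (f u)"
    and "height (f u) \<le> exp (2 * M) * height (f v)"
    and "dist (f u) (f v) \<le> M * exp (2 * M) * height (f u)"
proof -
  define p where "p s = (1 - s) *\<^sub>R u + s *\<^sub>R v" for s :: real
  define h where "h s = f (p s)" for s
  define H where "H s = height (h s)" for s
  have p_mem: "p s \<in> closed_segment u v" "p s \<in> A" if "s \<in> {0..1}" for s
    using that seg by (auto simp: p_def closed_segment_def)
  have dist_p: "dist (p s) (p s') = \<bar>s - s'\<bar> * dist u v" for s s'
  proof -
    have "p s - p s' = (s' - s) *\<^sub>R (u - v)"
      by (simp add: p_def algebra_simps)
    then show ?thesis
      by (simp add: dist_norm abs_minus_commute)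
  qed
  have H_pos: "0 < H s" if "s \<in> {0..1}" for s
    using A p_mem(2)[OF that] by (auto simp: H_def h_def mem_H4_iff)
  have M0: "0 \<le> M"
    using M m(1) \<kappa> by (smt (verit) divide_nonneg_pos mult_nonneg_nonneg zero_le_dist)
  have loc_h: "\<exists>d>0. \<forall>s'\<in>{0..1}. \<bar>s - s'\<bar> < d \<longrightarrow> dist (h s) (h s') \<le> M * H s * \<bar>s - s'\<bar>"
    if s: "s \<in> {0..1}" for s
  proof -
    obtain d where d: "0 < d" "\<And>x'. x' \<in> A \<Longrightarrow> dist (p s) x' < d \<Longrightarrow>
        dist (f (p s)) (f x') \<le> \<kappa> * (height (f (p s)) / height (p s)) * dist (p s) x'"
      using loc[OF p_mem(2)[OF s]] by blast
    have "dist (h s) (h s') \<le> M * H s * \<bar>s - s'\<bar>"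
      if s': "s' \<in> {0..1}" "\<bar>s - s'\<bar> < d / (dist u v + 1)" for s'
    proof -
      have "\<bar>s - s'\<bar> * dist u v \<le> \<bar>s - s'\<bar> * (dist u v + 1)"
        by (intro mult_left_mono) auto
      also have "\<dots> < d"
        using s'(2) by (simp add: pos_less_divide_eq add_nonneg_pos)
      finally have "dist (h s) (h s') \<le> \<kappa> * (H s / height (p s)) * (\<bar>s - s'\<bar> * dist u v)"
        using d(2)[OF p_mem(2)[OF s'(1)]] by (simp add: dist_p h_def H_def)
      also have "\<dots> \<le> \<kappa> * (H s / m) * (\<bar>s - s'\<bar> * dist u v)"
        using \<kappa> m(1) m(2)[OF p_mem(1)[OF s]] H_pos[OF s]
        by (intro mult_right_mono mult_left_mono divide_left_mono) auto
      also have "\<dots> = (\<kappa> * dist u v / m) * (H s * \<bar>s - s'\<bar>)"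
        by simp
      also have "\<dots> \<le> M * (H s * \<bar>s - s'\<bar>)"
        using M H_pos[OF s] by (intro mult_right_mono) auto
      finally show ?thesis
        by simp
    qed
    moreover have "0 < d / (dist u v + 1)"
      using d(1) by (simp add: add_nonneg_pos)
    ultimately show ?thesis
      by blast
  qed
  define P where "P a b \<longleftrightarrow> 0 \<le> a \<and> b \<le> 1 \<longrightarrow>
    H b \<le> exp (2 * M * (b - a)) * H a \<and> H a \<le> exp (2 * M * (b - a)) * H b" for a b
  have P_trans: "P a c" if "P a b" "P b c" "a \<le> b" "b \<le> c" for a b c
  proof -
    have split: "exp (2 * M * (c - a)) = exp (2 * M * (c - b)) * exp (2 * M * (b - a))"
      by (simp add: algebra_simps flip: exp_add)
    have "H c \<le> exp (2 * M * (c - a)) * H a \<and> H a \<le> exp (2 * M * (c - a)) * H c"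
      if "0 \<le> a" "c \<le> 1"
    proof -
      have ab: "H b \<le> exp (2 * M * (b - a)) * H a" "H a \<le> exp (2 * M * (b - a)) * H b"
        and bc: "H c \<le> exp (2 * M * (c - b)) * H b" "H b \<le> exp (2 * M * (c - b)) * H c"
        using \<open>P a b\<close> \<open>P b c\<close> that \<open>a \<le> b\<close> \<open>b \<le> c\<close> by (auto simp: P_def)
      show ?thesis
        using order_trans[OF bc(1) mult_left_mono[OF ab(1)]]
          order_trans[OF ab(2) mult_left_mono[OF bc(2)]]
        unfolding split by (intro conjI) (simp_all only: mult_ac exp_ge_zero)
    qed
    then show ?thesis
      by (simp add: P_def)
  qed
  have P_local: "\<exists>d>0. \<forall>a b. a \<le> s \<and> s \<le> b \<and> b - a < d \<longrightarrow> P a b" if s: "0 \<le> s" "s \<le> 1" for s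
  proof -
    obtain d where d: "0 < d"
      "\<And>s'. s' \<in> {0..1} \<Longrightarrow> \<bar>s - s'\<bar> < d \<Longrightarrow> dist (h s) (h s') \<le> M * H s * \<bar>s - s'\<bar>"
      using loc_h[of s] s by auto
    \<comment> \<open>the factor 2 in the exponent makes the local bound symmetric, because
      \<open>1 - e \<ge> exp (- 2 * e)\<close> for \<open>0 \<le> e \<le> 1/2\<close>\<close>
    have two_sided: "H s' \<le> exp (2 * (M * \<bar>s - s'\<bar>)) * H s \<and> H s \<le> exp (2 * (M * \<bar>s - s'\<bar>)) * H s'"
      if s': "s' \<in> {0..1}" "\<bar>s - s'\<bar> < min d (1 / (2 * M + 1))" for s'
    proof -
      define e where "e = M * \<bar>s - s'\<bar>"
      have "\<bar>s - s'\<bar> * (2 * M + 1) < 1"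
        using s'(2) M0 by (simp add: field_simps)
      then have e: "0 \<le> e" "e \<le> 1/2"
        using M0 by (auto simp: e_def algebra_simps)
      have "\<bar>H s - H s'\<bar> \<le> dist (h s) (h s')"
        unfolding H_def by (rule dist_components_le)
      also have "\<dots> \<le> e * H s"
        using d(2)[OF s'(1)] s'(2) by (simp add: e_def mult_ac)
      finally have diff: "\<bar>H s - H s'\<bar> \<le> e * H s" .
      have Hs: "0 < H s"
        using H_pos s by auto
      have "H s' \<le> (1 + 2 * e) * H s"
        using diff mult_nonneg_nonneg[OF e(1) less_imp_le[OF Hs]] by (simp add: algebra_simps)
      also have "\<dots> \<le> exp (2 * e) * H s"
        using Hs by (intro mult_right_mono exp_ge_add_one_self) auto
      finally have up: "H s' \<le> exp (2 * e) * H s" .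
      have "0 \<le> e * (1 - 2 * e)"
        using e by simp
      then have "1 \<le> (1 + 2 * e) * (1 - e)"
        by (simp add: algebra_simps)
      then have "H s \<le> (1 + 2 * e) * ((1 - e) * H s)"
        using Hs mult_right_mono[of 1 "(1 + 2 * e) * (1 - e)" "H s"] by (simp add: mult.assoc)
      also have "\<dots> \<le> (1 + 2 * e) * H s'"
        using diff e by (intro mult_left_mono) (auto simp: algebra_simps)
      also have "\<dots> \<le> exp (2 * e) * H s'"
        using H_pos[OF s'(1)] by (intro mult_right_mono exp_ge_add_one_self) auto
      finally show ?thesis
        using up by (simp add: e_def)
    qed
    have "P a b" if ab: "a \<le> s" "s \<le> b" "b - a < min d (1 / (2 * M + 1))" for a b
    proof (cases "0 \<le> a \<and> b \<le> 1")
      case True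
      have "P a s"
        using two_sided[of a] ab s True by (simp add: P_def mult_ac)
      moreover have "P s b"
        using two_sided[of b] ab s True by (simp add: P_def mult_ac)
      ultimately show ?thesis
        using P_trans ab by blast
    qed (auto simp: P_def)
    then show ?thesis
      using d(1) M0 by (intro exI[of _ "min d (1 / (2 * M + 1))"]) auto
  qed
  have P: "P 0 s" if "0 \<le> s" "s \<le> 1" for s
  proof (rule Bolzano)
    show "0 \<le> s" by fact
    show "\<exists>d>0. \<forall>a b. a \<le> x \<and> x \<le> b \<and> b - a < d \<longrightarrow> P a b" if "0 \<le> x" "x \<le> s" for x
      using P_local[of x] that \<open>s \<le> 1\<close> by simp
  qed (use P_trans in blast)
  have ends: "h 0 = f u" "h 1 = f v" "H 0 = height (f u)" "H 1 = height (f v)"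
    by (simp_all add: h_def p_def H_def)
  show "height (f v) \<le> exp (2 * M) * height (f u)" "height (f u) \<le> exp (2 * M) * height (f v)"
    using P[of 1] by (simp_all add: P_def ends)
  define C where "C = M * (exp (2 * M) * H 0)"
  have C: "M * H s \<le> C" if s: "s \<in> {0..1}" for s
  proof -
    have "H s \<le> exp (2 * M * s) * H 0"
      using P[of s] s by (simp add: P_def)
    also have "\<dots> \<le> exp (2 * M) * H 0"
      using s M0 H_pos[of 0] by (intro mult_right_mono) (auto simp: mult_left_le)
    finally show ?thesis
      unfolding C_def using M0 by (intro mult_left_mono) auto
  qed
  define R where "R a b \<longleftrightarrow> 0 \<le> a \<and> b \<le> 1 \<longrightarrow> dist (h a) (h b) \<le> C * (b - a)" for a b
  have R_trans: "R a c" if "R a b" "R b c" "a \<le> b" "b \<le> c" for a b c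
  proof -
    have "dist (h a) (h c) \<le> C * (c - a)" if "0 \<le> a" "c \<le> 1"
    proof -
      have "dist (h a) (h b) \<le> C * (b - a)" "dist (h b) (h c) \<le> C * (c - b)"
        using \<open>R a b\<close> \<open>R b c\<close> that \<open>a \<le> b\<close> \<open>b \<le> c\<close> by (auto simp: R_def)
      then show ?thesis
        using dist_triangle[of "h a" "h c" "h b"] by (simp add: algebra_simps)
    qed
    then show ?thesis
      by (simp add: R_def)
  qed
  have "R 0 1"
  proof (rule Bolzano)
    show "\<exists>d>0. \<forall>a b. a \<le> s \<and> s \<le> b \<and> b - a < d \<longrightarrow> R a b" if s: "0 \<le> s" "s \<le> 1" for s
    proof -
      obtain d where d: "0 < d"
        "\<And>s'. s' \<in> {0..1} \<Longrightarrow> \<bar>s - s'\<bar> < d \<Longrightarrow> dist (h s) (h s') \<le> M * H s * \<bar>s - s'\<bar>"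
        using loc_h[of s] s by auto
      have bound: "dist (h s) (h s') \<le> C * \<bar>s - s'\<bar>" if "s' \<in> {0..1}" "\<bar>s - s'\<bar> < d" for s'
        using d(2)[OF that] mult_right_mono[OF C, of s "\<bar>s - s'\<bar>"] s by simp
      have "R a b" if ab: "a \<le> s" "s \<le> b" "b - a < d" for a b
      proof (cases "0 \<le> a \<and> b \<le> 1")
        case True
        have "R a s"
          using bound[of a] ab s True by (simp add: R_def dist_commute)
        moreover have "R s b"
          using bound[of b] ab s True by (simp add: R_def)
        ultimately show ?thesis
          using R_trans ab by blast
      qed (auto simp: R_def)
      then show ?thesis
        using d(1) by blast
    qed
  qed (use R_trans in auto)
  then show "dist (f u) (f v) \<le> M * exp (2 * M) * height (f u)"
    by (simp add: R_def ends C_def mult_ac)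
qed

section \<open>Orbits and the quotient metric\<close>

lemma margulis_region_iff:
  "x \<in> margulis_region \<epsilon> \<gamma> \<longleftrightarrow> x \<in> H4 \<and> (\<exists>j::nat. 1 \<le> j \<and> hyp_dist (screw_power \<gamma> (int j) x) x < \<epsilon>)"
  by (auto simp: margulis_region_def screw_funpow)

lemma screw_power_mem_region [simp]:
  "screw_power \<gamma> i x \<in> margulis_region \<epsilon> \<gamma> \<longleftrightarrow> x \<in> margulis_region \<epsilon> \<gamma>"
proof -
  have "hyp_dist (screw_power \<gamma> j (screw_power \<gamma> i x)) (screw_power \<gamma> i x)
      = hyp_dist (screw_power \<gamma> j x) x" for j
    using hyp_dist_screw_power[of \<gamma> i "screw_power \<gamma> j x" x] by (simp add: add.commute)
  then show ?thesis
    by (simp only: margulis_region_iff screw_power_mem_H4)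
qed

definition screw_orbit :: "real \<Rightarrow> point \<Rightarrow> point set" where
  "screw_orbit \<gamma> x = range (\<lambda>j. screw_power \<gamma> j x)"

lemma screw_orbit_screw_power [simp]: "screw_orbit \<gamma> (screw_power \<gamma> j x) = screw_orbit \<gamma> x"
proof -
  have "screw_power \<gamma> i x \<in> range (\<lambda>i. screw_power \<gamma> (i + j) x)" for i
    by (rule range_eqI[of _ _ "i - j"]) simp
  then show ?thesis
    by (auto simp: screw_orbit_def)
qed

lemma orbit_rel_Image:
  assumes "x \<in> margulis_region \<epsilon> \<gamma>"
  shows "orbit_rel \<epsilon> \<gamma> `` {x} = screw_orbit \<gamma> x"
proof (intro equalityI subsetI)
  fix y assume "y \<in> orbit_rel \<epsilon> \<gamma> `` {x}"
  then obtain j :: nat where "y = screw_power \<gamma> (int j) x \<or> x = screw_power \<gamma> (int j) y"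
    by (auto simp: orbit_rel_def screw_funpow)
  then have "y = screw_power \<gamma> (int j) x \<or> y = screw_power \<gamma> (- int j) x"
    by auto
  then show "y \<in> screw_orbit \<gamma> x"
    by (auto simp: screw_orbit_def)
next
  fix y assume "y \<in> screw_orbit \<gamma> x"
  then obtain j where y: "y = screw_power \<gamma> j x"
    by (auto simp: screw_orbit_def)
  have "\<exists>m::nat. y = screw_power \<gamma> (int m) x \<or> x = screw_power \<gamma> (int m) y"
  proof (cases "0 \<le> j")
    case True
    then show ?thesis
      by (intro exI[of _ "nat j"]) (simp add: y)
  next
    case False
    then show ?thesis
      by (intro exI[of _ "nat (- j)"]) (simp add: y)
  qed
  moreover have "y \<in> margulis_region \<epsilon> \<gamma>"
    using assms by (simp add: y)
  ultimately show "y \<in> orbit_rel \<epsilon> \<gamma> `` {x}"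
    using assms by (simp add: orbit_rel_def screw_funpow)
qed

lemma margulis_cusp_eq: "margulis_cusp \<epsilon> \<gamma> = screw_orbit \<gamma> ` margulis_region \<epsilon> \<gamma>"
  by (auto simp: margulis_cusp_def quotient_def orbit_rel_Image)

lemma cusp_dist_less_iff:
  assumes "x \<in> H4" "y \<in> H4"
  shows "cusp_dist (screw_orbit \<gamma> x) (screw_orbit \<gamma> y) < e \<longleftrightarrow> (\<exists>j. hyp_dist x (screw_power \<gamma> j y) < e)"
proof -
  have eq: "{hyp_dist a b | a b. a \<in> screw_orbit \<gamma> x \<and> b \<in> screw_orbit \<gamma> y}
      = range (\<lambda>j. hyp_dist x (screw_power \<gamma> j y))" (is "?L = ?R")
  proof (intro equalityI subsetI)
    fix d assume "d \<in> ?R"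
    then obtain j where "d = hyp_dist (screw_power \<gamma> 0 x) (screw_power \<gamma> j y)"
      by auto
    then show "d \<in> ?L"
      unfolding screw_orbit_def by blast
  qed (auto simp: screw_orbit_def hyp_dist_screw_power_left)
  have "bdd_below ?R"
    using assms by (intro bdd_belowI[of _ 0]) (auto simp: hyp_dist_nonneg)
  then show ?thesis
    unfolding cusp_dist_def eq by (subst cInf_less_iff) auto
qed

text \<open>
  In terms of representatives, a bi-Lipschitz embedding of cusps is a map of Margulis
  regions, constant on orbits and in general discontinuous, with two-sided estimates in
  which a suitable point of the orbit is chosen.
\<close>

lemma bilipschitz_embedding_representatives:
  assumes "bilipschitz_embedding (margulis_cusp \<epsilon> \<alpha>) cusp_dist (margulis_cusp \<epsilon> \<beta>) cusp_dist \<phi>"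
  obtains Y :: "point \<Rightarrow> point" and k where "1 \<le> k"
    "\<And>x. x \<in> margulis_region \<epsilon> \<alpha> \<Longrightarrow> Y x \<in> margulis_region \<epsilon> \<beta>"
    "\<And>x j. Y (screw_power \<alpha> j x) = Y x"
    "\<And>x x' e. \<lbrakk>x \<in> margulis_region \<epsilon> \<alpha>; x' \<in> margulis_region \<epsilon> \<alpha>; hyp_dist x x' < e\<rbrakk>
      \<Longrightarrow> \<exists>j. hyp_dist (Y x) (screw_power \<beta> j (Y x')) < k * e"
    "\<And>x x' j e. \<lbrakk>x \<in> margulis_region \<epsilon> \<alpha>; x' \<in> margulis_region \<epsilon> \<alpha>;
        hyp_dist (Y x) (screw_power \<beta> j (Y x')) < e\<rbrakk>
      \<Longrightarrow> \<exists>m. hyp_dist x (screw_power \<alpha> m x') < k * e"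
proof -
  obtain k where k: "1 \<le> k" and lip:
    "\<And>X X'. X \<in> margulis_cusp \<epsilon> \<alpha> \<Longrightarrow> X' \<in> margulis_cusp \<epsilon> \<alpha> \<Longrightarrow>
      inverse k * cusp_dist X X' \<le> cusp_dist (\<phi> X) (\<phi> X') \<and> cusp_dist (\<phi> X) (\<phi> X') \<le> k * cusp_dist X X'"
    and into: "\<phi> ` margulis_cusp \<epsilon> \<alpha> \<subseteq> margulis_cusp \<epsilon> \<beta>"
    using assms unfolding bilipschitz_embedding_def by blast
  define Y where "Y x = (SOME y. y \<in> margulis_region \<epsilon> \<beta> \<and> \<phi> (screw_orbit \<alpha> x) = screw_orbit \<beta> y)" for x
  have Y: "Y x \<in> margulis_region \<epsilon> \<beta> \<and> \<phi> (screw_orbit \<alpha> x) = screw_orbit \<beta> (Y x)"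
    if "x \<in> margulis_region \<epsilon> \<alpha>" for x
  proof -
    have "\<phi> (screw_orbit \<alpha> x) \<in> screw_orbit \<beta> ` margulis_region \<epsilon> \<beta>"
      using that into unfolding margulis_cusp_eq by blast
    then have "\<exists>y. y \<in> margulis_region \<epsilon> \<beta> \<and> \<phi> (screw_orbit \<alpha> x) = screw_orbit \<beta> y"
      by blast
    then show ?thesis
      unfolding Y_def by (rule someI_ex)
  qed
  have H: "x \<in> H4" if "x \<in> margulis_region \<epsilon> \<gamma>" for x \<gamma>
    using that by (simp add: margulis_region_iff)
  show ?thesis
  proof (rule that[of k Y])
    fix x x' e
    assume x: "x \<in> margulis_region \<epsilon> \<alpha>" "x' \<in> margulis_region \<epsilon> \<alpha>"
    note lip_x = lip[of "screw_orbit \<alpha> x" "screw_orbit \<alpha> x'"]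
    have mem: "screw_orbit \<alpha> x \<in> margulis_cusp \<epsilon> \<alpha>" "screw_orbit \<alpha> x' \<in> margulis_cusp \<epsilon> \<alpha>"
      using x by (auto simp: margulis_cusp_eq)
    {
      assume "hyp_dist x x' < e"
      then have "hyp_dist x (screw_power \<alpha> 0 x') < e"
        by simp
      then have "cusp_dist (screw_orbit \<alpha> x) (screw_orbit \<alpha> x') < e"
        using x H by (subst cusp_dist_less_iff) blast+
      then have "k * cusp_dist (screw_orbit \<alpha> x) (screw_orbit \<alpha> x') < k * e"
        using k by simp
      then have "cusp_dist (screw_orbit \<beta> (Y x)) (screw_orbit \<beta> (Y x')) < k * e"
        using lip_x[OF mem] Y x by simp
      then show "\<exists>j. hyp_dist (Y x) (screw_power \<beta> j (Y x')) < k * e"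
        using x Y H by (subst (asm) cusp_dist_less_iff) blast+
    next
      fix j
      assume "hyp_dist (Y x) (screw_power \<beta> j (Y x')) < e"
      then have "cusp_dist (screw_orbit \<beta> (Y x)) (screw_orbit \<beta> (Y x')) < e"
        using x Y H by (subst cusp_dist_less_iff) blast+
      then have "inverse k * cusp_dist (screw_orbit \<alpha> x) (screw_orbit \<alpha> x') < e"
        using lip_x[OF mem] Y x by simp
      then have "cusp_dist (screw_orbit \<alpha> x) (screw_orbit \<alpha> x') < k * e"
        using k by (simp add: field_simps)
      then show "\<exists>m. hyp_dist x (screw_power \<alpha> m x') < k * e"
        using x H by (subst (asm) cusp_dist_less_iff) blast+
    }
  qed (use k Y in \<open>auto simp: Y_def\<close>)
qed

section \<open>Lifting to the upper half-space\<close>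

text \<open>
  Untwisting the angle makes the quotient of the half-space by the screw translation a
  product with a circle: these coordinates separate the orbits, and the circle coordinate
  is the only one that has to be lifted.
\<close>

definition orbit_coords :: "real \<Rightarrow> point \<Rightarrow> complex \<times> complex \<times> real" where
  "orbit_coords \<gamma> = (\<lambda>(w, z, t). (cis (- 2 * pi * \<gamma> * z) * w, cis (2 * pi * z), t))"

lemma orbit_coords_simp:
  "orbit_coords \<gamma> (w, z, t) = (cis (- 2 * pi * \<gamma> * z) * w, cis (2 * pi * z), t)"
  by (simp add: orbit_coords_def)

lemma continuous_on_orbit_coords: "continuous_on S (orbit_coords \<gamma>)"
  unfolding orbit_coords_def case_prod_unfold by (intro continuous_intros)

lemma cis_eq_imp_int:
  assumes "cis (2 * pi * a) = cis (2 * pi * b)"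
  obtains j :: int where "b = a + j"
proof -
  obtain n :: int where "2 * pi * b = 2 * pi * a + 2 * pi * n"
    using assms sin_cos_eq_iff[of "2 * pi * b" "2 * pi * a"] by (auto simp: complex_eq_iff)
  then have "2 * pi * b = 2 * pi * (a + n)"
    by (simp add: distrib_left)
  then show ?thesis
    using that by simp
qed

lemma orbit_coords_eq_iff: "orbit_coords \<gamma> x = orbit_coords \<gamma> y \<longleftrightarrow> (\<exists>j. y = screw_power \<gamma> j x)"
proof (cases x; cases y)
  fix w z t w' z' t' assume x: "x = (w, z, t)" and y: "y = (w', z', t')"
  have shift: "cis (- 2 * pi * \<gamma> * (z + j)) * w' = cis (- 2 * pi * \<gamma> * z) * w \<longleftrightarrow>
      w' = cis (2 * pi * \<gamma> * j) * w" for j :: int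
  proof -
    have "- 2 * pi * \<gamma> * (z + j) + 2 * pi * \<gamma> * j = - 2 * pi * \<gamma> * z"
      by (simp add: algebra_simps)
    then have "cis (- 2 * pi * \<gamma> * (z + j)) * (cis (2 * pi * \<gamma> * j) * w) = cis (- 2 * pi * \<gamma> * z) * w"
      by (simp only: cis_mult flip: mult.assoc)
    then show ?thesis
      by (metis cis_neq_zero mult_left_cancel)
  qed
  have per: "cis (2 * pi * (z + of_int j)) = cis (2 * pi * z)" for j
    by (simp add: distrib_left flip: cis_mult)
  show ?thesis
  proof
    assume eq: "orbit_coords \<gamma> x = orbit_coords \<gamma> y"
    then obtain j :: int where "z' = z + j"
      using cis_eq_imp_int[of z z'] by (auto simp: x y orbit_coords_simp)
    then show "\<exists>j. y = screw_power \<gamma> j x"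
      using eq shift[of j] by (intro exI[of _ j]) (simp add: x y orbit_coords_simp screw_power_simp)
  next
    assume "\<exists>j. y = screw_power \<gamma> j x"
    then obtain j :: int where j: "w' = cis (2 * pi * \<gamma> * j) * w" "z' = z + j" "t' = t"
      by (auto simp: x y screw_power_simp)
    show "orbit_coords \<gamma> x = orbit_coords \<gamma> y"
      using iffD2[OF shift j(1)] per[of j] by (simp only: x y orbit_coords_simp j(2,3))
  qed
qed

lemma hyp_close_imp_close:
  assumes y: "y \<in> H4" and \<delta>: "0 < \<delta>"
  shows "\<exists>\<eta>>0. \<forall>y'\<in>H4. hyp_dist y y' < \<eta> \<longrightarrow> dist y y' < \<delta>"
proof -
  define \<tau> where "\<tau> = height y"
  have \<tau>: "0 < \<tau>"
    using y by (simp add: \<tau>_def mem_H4_iff)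
  define \<eta> where "\<eta> = min 1 (\<delta> / (3 * \<tau>))"
  have \<eta>: "0 < \<eta>" "\<eta> \<le> 1" "\<eta> * (3 * \<tau>) \<le> \<delta>"
    using \<tau> \<delta> by (auto simp: \<eta>_def min_def field_simps)
  have C: "cosh \<eta> - 1 \<le> \<eta>\<^sup>2" "cosh \<eta> \<le> 2" "1 \<le> cosh \<eta>"
    using cosh_minus_one_le[of \<eta>] \<eta> power_le_one[of \<eta> 2] cosh_real_ge_1[of \<eta>] by auto
  have "dist y y' < \<delta>" if y': "y' \<in> H4" "hyp_dist y y' < \<eta>" for y'
  proof -
    have *: "(dist y y')\<^sup>2 < 2 * height y * height y' * (cosh \<eta> - 1)"
      using y y' by (simp add: hyp_dist_less_iff)
    have "height y' \<le> 2 * cosh \<eta> * \<tau>"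
      unfolding \<tau>_def using height_ratio_le[OF y y'(1) less_imp_le[OF *]] .
    also have "\<dots> \<le> 2 * 2 * \<tau>"
      using C \<tau> by (intro mult_right_mono mult_left_mono) auto
    finally have "2 * \<tau> * height y' * (cosh \<eta> - 1) \<le> 2 * \<tau> * (2 * 2 * \<tau>) * \<eta>\<^sup>2"
      using C \<tau> y'(1) by (intro mult_mono) (auto simp: mem_H4_iff)
    also have "\<dots> \<le> (\<eta> * (3 * \<tau>))\<^sup>2"
      using zero_le_power2[of "\<eta> * \<tau>"] by (simp add: power2_eq_square mult_ac)
    also have "\<dots> \<le> \<delta>\<^sup>2"
      using \<eta> \<tau> by (intro power_mono) auto
    finally show ?thesis
      using * \<delta> by (intro power2_less_imp_less[of "dist y y'" \<delta>]) (auto simp: \<tau>_def)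
  qed
  then show ?thesis
    using \<eta>(1) by blast
qed

lemma close_imp_hyp_close:
  assumes x: "x \<in> H4" and \<eta>: "0 < \<eta>"
  shows "\<exists>d>0. \<forall>x'\<in>H4. dist x x' < d \<longrightarrow> hyp_dist x x' < \<eta>"
proof -
  define S where "S = {x'. (dist x x')\<^sup>2 < 2 * height x * height x' * (cosh \<eta> - 1)}"
  have "open S"
    unfolding S_def by (intro open_Collect_less continuous_intros)
  moreover have "x \<in> S"
    using x \<eta> cosh_real_nonneg_less_iff[of 0 \<eta>] by (simp add: S_def mem_H4_iff)
  ultimately obtain d where "0 < d" "ball x d \<subseteq> S"
    by (auto simp: open_contains_ball)
  then show ?thesis
    using x \<eta> by (intro exI[of _ d]) (auto simp: S_def hyp_dist_less_iff subset_iff)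
qed

text \<open>
  Over a convex invariant domain the map of quotients lifts to a continuous equivariant map:
  its circle coordinate has a continuous logarithm, and the integer by which the lift
  intertwines the two screw translations is constant because the domain is connected.
\<close>

lemma lift_quotient_map:
  fixes Y :: "point \<Rightarrow> point"
  assumes D: "convex D" "D \<subseteq> H4" "\<And>x j. x \<in> D \<Longrightarrow> screw_power \<alpha> j x \<in> D"
    and Y: "\<And>x. x \<in> D \<Longrightarrow> Y x \<in> H4" "\<And>x j. Y (screw_power \<alpha> j x) = Y x"
    and k: "1 \<le> k" and lip: "\<And>x x' e. \<lbrakk>x \<in> D; x' \<in> D; hyp_dist x x' < e\<rbrakk>
      \<Longrightarrow> \<exists>j. hyp_dist (Y x) (screw_power \<beta> j (Y x')) < k * e"
  obtains \<Phi> n where "continuous_on D \<Phi>"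
    "\<And>x. x \<in> D \<Longrightarrow> \<exists>i. \<Phi> x = screw_power \<beta> i (Y x)"
    "\<And>x m. x \<in> D \<Longrightarrow> \<Phi> (screw_power \<alpha> m x) = screw_power \<beta> (n * m) (\<Phi> x)"
proof -
  define F where "F x = orbit_coords \<beta> (Y x)" for x
  have F_cont: "continuous_on D F"
    unfolding continuous_on_iff
  proof (intro ballI allI impI)
    fix x and e :: real assume x: "x \<in> D" and "0 < e"
    then obtain \<delta> where \<delta>: "0 < \<delta>" "\<And>y. dist y (Y x) < \<delta> \<Longrightarrow> dist (orbit_coords \<beta> y) (F x) < e"
      using continuous_on_orbit_coords[of UNIV \<beta>] unfolding continuous_on_iff F_def by blast
    obtain \<eta> where \<eta>: "0 < \<eta>" "\<And>y'. y' \<in> H4 \<Longrightarrow> hyp_dist (Y x) y' < \<eta> \<Longrightarrow> dist (Y x) y' < \<delta>"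
      using hyp_close_imp_close[OF Y(1)[OF x] \<delta>(1)] by blast
    have "0 < \<eta> / k"
      using \<eta>(1) k by simp
    from close_imp_hyp_close[OF subsetD[OF D(2) x] this]
    obtain d where d: "0 < d" "\<And>x'. x' \<in> H4 \<Longrightarrow> dist x x' < d \<Longrightarrow> hyp_dist x x' < \<eta> / k"
      by blast
    have "dist (F x') (F x) < e" if x': "x' \<in> D" "dist x' x < d" for x'
    proof -
      obtain j where j: "hyp_dist (Y x) (screw_power \<beta> j (Y x')) < k * (\<eta> / k)"
        using lip[OF x x'(1) d(2)] x' D(2) by (auto simp: dist_commute)
      then have "dist (Y x) (screw_power \<beta> j (Y x')) < \<delta>"
        using \<eta>(2) k Y(1)[OF x'(1)] by simp
      then have "dist (orbit_coords \<beta> (screw_power \<beta> j (Y x'))) (F x) < e"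
        by (intro \<delta>(2)) (simp add: dist_commute)
      moreover have "orbit_coords \<beta> (screw_power \<beta> j (Y x')) = F x'"
        unfolding F_def using orbit_coords_eq_iff by metis
      ultimately show ?thesis
        by simp
    qed
    then show "\<exists>d>0. \<forall>x'\<in>D. dist x' x < d \<longrightarrow> dist (F x') (F x) < e"
      using d(1) by blast
  qed
  have norm_1: "cmod (fst (snd (F x))) = 1" for x
    by (cases "Y x") (simp add: F_def orbit_coords_simp)
  obtain g where g: "continuous_on D g" "\<And>x. x \<in> D \<Longrightarrow> fst (snd (F x)) = exp (g x)"
  proof (rule continuous_logarithm_on_contractible)
    show "continuous_on D (\<lambda>x. fst (snd (F x)))"
      by (intro continuous_intros F_cont)
    show "contractible D"
      using D(1) by (rule convex_imp_contractible)
    show "fst (snd (F x)) \<noteq> 0" for x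
      using norm_1[of x] by auto
  qed (rule that)
  define \<zeta> where "\<zeta> x = Im (g x) / (2 * pi)" for x
  have \<zeta>_cont: "continuous_on D \<zeta>"
    unfolding \<zeta>_def by (intro continuous_intros g(1)) auto
  have cis_\<zeta>: "cis (2 * pi * \<zeta> x) = fst (snd (F x))" if "x \<in> D" for x
  proof -
    have "exp (Re (g x)) = 1"
      using norm_1[of x] g(2)[OF that] norm_exp_eq_Re[of "g x"] by simp
    then show ?thesis
      using g(2)[OF that] exp_eq_polar[of "g x"] by (simp add: \<zeta>_def)
  qed
  define \<Phi> where "\<Phi> x = (cis (2 * pi * \<beta> * \<zeta> x) * fst (F x), \<zeta> x, snd (snd (F x)))" for x
  have \<Phi>_cont: "continuous_on D \<Phi>"
    unfolding \<Phi>_def by (intro continuous_intros F_cont \<zeta>_cont)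
  have coords: "orbit_coords \<beta> (\<Phi> x) = F x" if "x \<in> D" for x
  proof -
    have "cis (- 2 * pi * \<beta> * \<zeta> x) * (cis (2 * pi * \<beta> * \<zeta> x) * u) = u" for u
      by (simp add: cis_mult flip: mult.assoc)
    then show ?thesis
      using cis_\<zeta>[OF that] by (simp add: \<Phi>_def orbit_coords_simp prod_eq_iff)
  qed
  have one_step: "\<exists>j. \<Phi> (screw_power \<alpha> 1 x) = screw_power \<beta> j (\<Phi> x)" if x: "x \<in> D" for x
  proof -
    have "orbit_coords \<beta> (\<Phi> x) = orbit_coords \<beta> (\<Phi> (screw_power \<alpha> 1 x))"
      using coords[OF x] coords[OF D(3)[OF x]] Y(2) by (simp add: F_def)
    then show ?thesis
      by (simp add: orbit_coords_eq_iff)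
  qed
  define \<nu> where "\<nu> x = fst (snd (\<Phi> (screw_power \<alpha> 1 x))) - fst (snd (\<Phi> x))" for x
  have \<nu>_int: "\<exists>j::int. \<nu> x = j \<and> \<Phi> (screw_power \<alpha> 1 x) = screw_power \<beta> j (\<Phi> x)" if "x \<in> D" for x
    using one_step[OF that] by (auto simp: \<nu>_def)
  have "\<nu> constant_on D"
  proof (rule continuous_discrete_range_constant)
    show "connected D"
      using D(1) by (rule convex_connected)
    have "continuous_on D (\<lambda>x. \<Phi> (screw_power \<alpha> 1 x))"
      by (rule continuous_on_compose2[OF \<Phi>_cont continuous_on_screw_power]) (use D(3) in auto)
    then show "continuous_on D \<nu>"
      unfolding \<nu>_def by (intro continuous_intros \<Phi>_cont)
    show "\<exists>e>0. \<forall>y. y \<in> D \<and> \<nu> y \<noteq> \<nu> x \<longrightarrow> e \<le> norm (\<nu> y - \<nu> x)" if x: "x \<in> D" for x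
    proof (intro exI[of _ 1] conjI allI impI)
      fix y assume y: "y \<in> D \<and> \<nu> y \<noteq> \<nu> x"
      then obtain i j :: int where "\<nu> x = i" "\<nu> y = j"
        using \<nu>_int x by meson
      moreover from this have "1 \<le> \<bar>j - i\<bar>"
        using y by auto
      ultimately show "1 \<le> norm (\<nu> y - \<nu> x)"
        by (simp flip: of_int_diff of_int_abs)
    qed simp
  qed
  then obtain n :: int where n: "\<And>x. x \<in> D \<Longrightarrow> \<Phi> (screw_power \<alpha> 1 x) = screw_power \<beta> n (\<Phi> x)"
    using \<nu>_int unfolding constant_on_def by (metis of_int_eq_iff)
  have up: "\<Phi> (screw_power \<alpha> (int m) x) = screw_power \<beta> (n * int m) (\<Phi> x)" if "x \<in> D" for m x
  proof (induction m)
    case (Suc m)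
    have "\<Phi> (screw_power \<alpha> (int (Suc m)) x) = \<Phi> (screw_power \<alpha> 1 (screw_power \<alpha> (int m) x))"
      by simp
    also have "\<dots> = screw_power \<beta> (n * int (Suc m)) (\<Phi> x)"
      unfolding n[OF D(3)[OF that]] Suc by (simp add: algebra_simps)
    finally show ?case .
  qed simp
  show ?thesis
  proof (rule that[of \<Phi> n])
    show "continuous_on D \<Phi>" by fact
    show "\<exists>i. \<Phi> x = screw_power \<beta> i (Y x)" if "x \<in> D" for x
      using coords[OF that] by (simp add: F_def eq_commute flip: orbit_coords_eq_iff)
    show "\<Phi> (screw_power \<alpha> m x) = screw_power \<beta> (n * m) (\<Phi> x)" if x: "x \<in> D" for x m
    proof (cases "0 \<le> m")
      case True
      then show ?thesis
        using up[OF x, of "nat m"] by simp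
    next
      case False
      then have "\<Phi> x = screw_power \<beta> (n * - m) (\<Phi> (screw_power \<alpha> m x))"
        using up[OF D(3)[OF x], of "nat (- m)" m] by simp
      then have "screw_power \<beta> (n * m) (\<Phi> x)
          = screw_power \<beta> (n * m) (screw_power \<beta> (n * - m) (\<Phi> (screw_power \<alpha> m x)))"
        by simp
      then show ?thesis
        by simp
    qed
  qed
qed

section \<open>Lifted embeddings\<close>

locale lifted_embedding =
  fixes \<alpha> \<beta> k :: real and D :: "point set" and \<Phi> :: "point \<Rightarrow> point" and n :: int
  assumes k: "1 \<le> k"
    and open_D: "open D" and convex_D: "convex D" and D_H4: "D \<subseteq> H4"
    and D_screw: "x \<in> D \<Longrightarrow> screw_power \<alpha> j x \<in> D"
    and cont: "continuous_on D \<Phi>" and \<Phi>_H4: "\<Phi> ` D \<subseteq> H4"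
    and upper: "\<lbrakk>x \<in> D; x' \<in> D; hyp_dist x x' < e\<rbrakk>
      \<Longrightarrow> \<exists>j. hyp_dist (\<Phi> x) (screw_power \<beta> j (\<Phi> x')) < k * e"
    and lower: "\<lbrakk>x \<in> D; x' \<in> D; hyp_dist (\<Phi> x) (screw_power \<beta> j (\<Phi> x')) < e\<rbrakk>
      \<Longrightarrow> \<exists>m. hyp_dist x (screw_power \<alpha> m x') < k * e"
    and equivariant: "x \<in> D \<Longrightarrow> \<Phi> (screw_power \<alpha> m x) = screw_power \<beta> (n * m) (\<Phi> x)"
begin

lemma orbit_injective:
  assumes x: "x \<in> D" and x': "x' \<in> D" and eq: "\<Phi> x' = screw_power \<beta> j (\<Phi> x)"
  shows "\<exists>m. x' = screw_power \<alpha> m x \<and> j = n * m"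
proof -
  have H: "x \<in> H4" "x' \<in> H4"
    using x x' D_H4 by auto
  have close: "\<exists>m. dist x' (screw_power \<alpha> m x) < \<delta>" if \<delta>: "0 < \<delta>" for \<delta>
  proof -
    obtain \<eta> where \<eta>: "0 < \<eta>" "\<And>y'. y' \<in> H4 \<Longrightarrow> hyp_dist x' y' < \<eta> \<Longrightarrow> dist x' y' < \<delta>"
      using hyp_close_imp_close[OF H(2) \<delta>] by blast
    have "hyp_dist (\<Phi> x') (screw_power \<beta> j (\<Phi> x)) < \<eta> / k"
      using \<eta>(1) k by (simp add: eq)
    then obtain m where "hyp_dist x' (screw_power \<alpha> m x) < k * (\<eta> / k)"
      using lower[OF x' x] by blast
    then show ?thesis
      using \<eta>(2) k H by (intro exI[of _ m]) simp
  qed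
  obtain m where m: "dist x' (screw_power \<alpha> m x) < 1/2"
    using close[of "1/2"] by auto
  have "dist x' (screw_power \<alpha> m x) < \<delta>" if \<delta>: "0 < \<delta>" for \<delta>
  proof -
    obtain i where i: "dist x' (screw_power \<alpha> i x) < min \<delta> (1/2)"
      using close[of "min \<delta> (1/2)"] \<delta> by auto
    then have "\<bar>real_of_int i - real_of_int m\<bar> < 1"
      using m dist_components_le(2)[of x' "screw_power \<alpha> m x"]
        dist_components_le(2)[of x' "screw_power \<alpha> i x"]
      unfolding fst_snd_screw_power min_less_iff_conj by linarith
    then have "i = m"
      by linarith
    then show ?thesis
      using i by simp
  qed
  then have "x' = screw_power \<alpha> m x"
    by (metis dist_pos_lt less_irrefl)
  moreover from this have "j = n * m"
    using eq equivariant[OF x, of m] by simp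
  ultimately show ?thesis
    by blast
qed

text \<open>
  Points with the same image differ by a power of the screw, so the map is injective on slabs
  of thickness one, and invariance of domain applies to each of them. For \<open>n = 0\<close>, which can only
  be excluded later, the map is not injective on all of \<open>D\<close>.
\<close>

lemma open_image:
  assumes "open U" "U \<subseteq> D"
  shows "open (\<Phi> ` U)"
proof -
  \<comment> \<open>slabs of thickness one contain at most one point of each orbit\<close>
  define S where "S c = U \<inter> {x. c < fst (snd x) \<and> fst (snd x) < c + 1}" for c
  have "open (\<Phi> ` S c)" for c
  proof (rule invariance_of_domain)
    show "continuous_on (S c) \<Phi>"
      using cont by (rule continuous_on_subset) (use assms in \<open>auto simp: S_def\<close>)
    show "open (S c)"
      unfolding S_def by (intro open_Int open_Collect_conj open_Collect_less continuous_intros assms)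
    show "inj_on \<Phi> (S c)"
    proof (rule inj_onI)
      fix x x' assume xx': "x \<in> S c" "x' \<in> S c" and "\<Phi> x = \<Phi> x'"
      then obtain m where m: "x' = screw_power \<alpha> m x"
        using orbit_injective[of x x' 0] assms by (auto simp: S_def)
      then have "\<bar>real_of_int m\<bar> < 1"
        using xx' by (auto simp: S_def)
      then have "m = 0"
        by linarith
      then show "x = x'"
        using m by simp
    qed
  qed
  moreover have "\<Phi> ` U = (\<Union>c. \<Phi> ` S c)"
  proof (intro equalityI subsetI)
    fix y assume "y \<in> \<Phi> ` U"
    then obtain x where "x \<in> U" "y = \<Phi> x"
      by blast
    then have "x \<in> S (fst (snd x) - 1/2)"
      by (auto simp: S_def)
    then show "y \<in> (\<Union>c. \<Phi> ` S c)"
      using \<open>y = \<Phi> x\<close> by blast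
  qed (auto simp: S_def)
  ultimately show ?thesis
    by auto
qed

text \<open>
  A lower Lipschitz bound turns room around \<open>x\<close> into room around \<open>\<Phi> x\<close>. The preimage of the
  embedded quotient is open by invariance of domain, and inside the ball it is closed
  because only the compact set \<open>K\<close> can contribute; so it contains the connected ball. It
  is the disjoint union of translates of \<open>\<Phi> ` D\<close>, all open, hence the ball lies in a
  single one.
\<close>

lemma ball_subset_image:
  assumes x0: "x0 \<in> D" and K: "compact K" "K \<subseteq> D"
    and ball_K: "\<And>x. \<lbrakk>x \<in> H4; hyp_dist x0 x < k * L\<rbrakk> \<Longrightarrow> x \<in> K"
  shows "hyp_ball (\<Phi> x0) L \<subseteq> \<Phi> ` D"
proof (cases "0 < L")
  case L: True
  define B where "B = hyp_ball (\<Phi> x0) L"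
  define Q where "Q = orbit_coords \<beta> -` (orbit_coords \<beta> ` \<Phi> ` K)"
  have H: "\<Phi> x0 \<in> H4"
    using x0 \<Phi>_H4 by auto
  have "compact (orbit_coords \<beta> ` \<Phi> ` K)"
    using K continuous_on_subset[OF cont K(2)] continuous_on_orbit_coords
    by (intro compact_continuous_image)
  then have "closed Q"
    unfolding Q_def
    using continuous_on_orbit_coords[of UNIV \<beta>] by (intro closed_vimage compact_imp_closed) auto
  have Q_B: "y \<in> Q" if y: "y \<in> B" "y = screw_power \<beta> i (\<Phi> x)" "x \<in> D" for y i x
  proof -
    have "hyp_dist (\<Phi> x0) (screw_power \<beta> i (\<Phi> x)) < L"
      using y by (simp add: B_def hyp_ball_def)
    then obtain m where "hyp_dist x0 (screw_power \<alpha> m x) < k * L"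
      using lower[OF x0 y(3)] by blast
    then have "screw_power \<alpha> m x \<in> K"
      using ball_K D_screw[OF y(3)] D_H4 by blast
    moreover have "orbit_coords \<beta> y = orbit_coords \<beta> (\<Phi> (screw_power \<alpha> m x))"
      unfolding orbit_coords_eq_iff equivariant[OF y(3)] y(2)
      by (intro exI[of _ "n * m - i"]) simp
    ultimately show ?thesis
      unfolding Q_def by blast
  qed
  \<comment> \<open>the translates of \<open>\<Phi> ` D\<close> disjoint from it; all other translates equal it\<close>
  define I where "I = {i. screw_power \<beta> i ` \<Phi> ` D \<inter> \<Phi> ` D = {}}"
  define V where "V = (\<Union>i\<in>I. screw_power \<beta> i ` \<Phi> ` D) \<union> - Q"
  have open_W: "open (\<Phi> ` D)"
    using open_image[OF open_D] by simp
  then have "open V"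
    unfolding V_def using \<open>closed Q\<close> by (intro open_Un open_UN ballI open_screw_power_image) auto
  have "B \<subseteq> \<Phi> ` D \<union> V"
  proof
    fix y assume "y \<in> B"
    show "y \<in> \<Phi> ` D \<union> V"
    proof (cases "y \<in> Q")
      case True
      then obtain x where x: "x \<in> K" and "orbit_coords \<beta> (\<Phi> x) = orbit_coords \<beta> y"
        by (auto simp: Q_def)
      then obtain i where i: "y = screw_power \<beta> i (\<Phi> x)"
        by (auto simp: orbit_coords_eq_iff)
      have xD: "x \<in> D"
        using x K(2) by blast
      show ?thesis
      proof (cases "i \<in> I")
        case True
        then show ?thesis
          using i xD unfolding V_def by blast
      next
        case False
        then obtain u v where "u \<in> D" "v \<in> D" "\<Phi> v = screw_power \<beta> i (\<Phi> u)"
          by (auto simp: I_def) metis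
        then obtain m where "i = n * m"
          using orbit_injective by blast
        then have "y = \<Phi> (screw_power \<alpha> m x)"
          using equivariant[OF xD] i by simp
        then show ?thesis
          using D_screw[OF xD] by blast
      qed
    qed (simp add: V_def)
  qed
  moreover have "\<Phi> ` D \<inter> V \<inter> B = {}"
  proof -
    have "y \<in> Q" if y: "y \<in> \<Phi> ` D" "y \<in> B" for y
    proof -
      obtain x where "x \<in> D" "y = \<Phi> x"
        using y(1) by blast
      then show ?thesis
        using Q_B[OF y(2), of 0 x] by simp
    qed
    then show ?thesis
      unfolding V_def I_def by blast
  qed
  moreover have "connected B"
    unfolding B_def using H by (intro convex_connected convex_hyp_ball)
  moreover have "\<Phi> x0 \<in> \<Phi> ` D \<inter> B"
    using x0 H L by (auto simp: B_def hyp_ball_def)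
  ultimately have "V \<inter> B = {}"
    using connectedD[OF _ open_W \<open>open V\<close>] by blast
  then show ?thesis
    using \<open>B \<subseteq> \<Phi> ` D \<union> V\<close> unfolding B_def by blast
next
  case False
  have "\<not> hyp_dist (\<Phi> x0) y < L" if "y \<in> H4" for y
    using hyp_dist_nonneg[of "\<Phi> x0" y] x0 \<Phi>_H4 that False by fastforce
  then show ?thesis
    by (auto simp: hyp_ball_def)
qed

lemma image_along_segment:
  assumes "closed_segment u v \<subseteq> D" "0 < c" "\<And>p. p \<in> closed_segment u v \<Longrightarrow> c \<le> height p"
    and "2 * k * dist u v / c \<le> M"
  shows "height (\<Phi> u) \<le> exp (2 * M) * height (\<Phi> v)"
    and "dist (\<Phi> u) (\<Phi> v) \<le> M * exp (2 * M) * height (\<Phi> u)"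
  using local_lipschitz_along_segment(2,3)[OF assms(1) \<Phi>_H4 _ assms(2,3) _ assms(4)]
    quotient_lipschitz_imp_local[OF D_H4 \<Phi>_H4 cont k upper] k by auto

lemma inj_on_domain:
  assumes "n \<noteq> 0"
  shows "inj_on \<Phi> D"
proof (rule inj_onI)
  fix x x' assume "x \<in> D" "x' \<in> D" "\<Phi> x = \<Phi> x'"
  then obtain m where "x' = screw_power \<alpha> m x" "0 = n * m"
    using orbit_injective[of x x' 0] by auto
  then show "x = x'"
    using assms by simp
qed

lemma preimage_along_segment:
  assumes "n \<noteq> 0" and u: "u \<in> D" and v: "v \<in> D"
    and seg: "closed_segment (\<Phi> u) (\<Phi> v) \<subseteq> \<Phi> ` D"
    and c: "0 < c" "\<And>p. p \<in> closed_segment (\<Phi> u) (\<Phi> v) \<Longrightarrow> c \<le> height p"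
    and M: "2 * k * dist (\<Phi> u) (\<Phi> v) / c \<le> M"
  shows "dist u v \<le> M * exp (2 * M) * height u"
proof -
  define \<Psi> where "\<Psi> = inv_into D \<Phi>"
  have inv: "\<Psi> (\<Phi> x) = x" if "x \<in> D" for x
    unfolding \<Psi>_def using inj_on_domain[OF \<open>n \<noteq> 0\<close>] that by (rule inv_into_f_f)
  have \<Psi>_H4: "\<Psi> ` \<Phi> ` D \<subseteq> H4"
    using inv D_H4 by auto
  have \<Psi>_cont: "continuous_on (\<Phi> ` D) \<Psi>"
    using inv by (intro continuous_on_inverse_open[OF open_D cont]) auto
  have \<Psi>_lip: "\<exists>m. hyp_dist (\<Psi> y) (screw_power \<alpha> m (\<Psi> y')) < k * e"
    if y: "y \<in> \<Phi> ` D" "y' \<in> \<Phi> ` D" "hyp_dist y y' < e" for y y' e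
  proof -
    obtain x x' where "x \<in> D" "x' \<in> D" "y = \<Phi> x" "y' = \<Phi> x'"
      using y by blast
    then show ?thesis
      using lower[of x x' 0 e] y(3) inv by simp
  qed
  have "dist (\<Psi> (\<Phi> u)) (\<Psi> (\<Phi> v)) \<le> M * exp (2 * M) * height (\<Psi> (\<Phi> u))"
    using k by (intro local_lipschitz_along_segment(3)[OF seg \<Psi>_H4 _ c _ M]
        quotient_lipschitz_imp_local[OF \<Phi>_H4 \<Psi>_H4 \<Psi>_cont k \<Psi>_lip]) auto
  then show ?thesis
    by (simp add: inv u v)
qed

end

section \<open>Rotation sizes determine the angle up to sign\<close>

lemma rotation_size_eq_sin: "rotation_size x = 2 * \<bar>sin (pi * x)\<bar>"
  using dist_exp_i_1[of "2 * pi * x"] by (simp add: rotation_size_def cis_conv_exp)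

lemma rotation_size_eq_0_iff: "rotation_size x = 0 \<longleftrightarrow> x \<in> \<int>"
proof -
  have "sin (pi * x) = 0 \<longleftrightarrow> (\<exists>i::int. x = i)"
    by (simp add: sin_zero_iff_int2 mult.commute)
  then show ?thesis
    by (auto simp: rotation_size_eq_sin Ints_def)
qed

lemma rotation_size_pos:
  assumes "\<gamma> \<notin> \<rat>" "j \<noteq> 0"
  shows "0 < rotation_size (\<gamma> * of_int j)"
proof -
  have "\<gamma> * of_int j \<notin> \<int>"
  proof
    assume "\<gamma> * of_int j \<in> \<int>"
    then have "\<gamma> * of_int j / of_int j \<in> \<rat>"
      using Ints_subset_Rats by (intro Rats_divide) auto
    then show False
      using assms by simp
  qed
  then show ?thesis
    using rotation_size_eq_0_iff rotation_size_nonneg by (metis less_eq_real_def)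
qed

lemma rotation_size_diff_int: "rotation_size (x - of_int m) = rotation_size x"
proof -
  have "cis (2 * pi * (x - of_int m)) = cis (2 * pi * x)"
    by (simp add: right_diff_distrib flip: cis_divide)
  then show ?thesis
    by (simp add: rotation_size_def)
qed

lemma rotation_size_le_abs: "rotation_size x \<le> 8 * \<bar>x\<bar>"
proof -
  have "rotation_size x \<le> 2 * (pi * \<bar>x\<bar>)"
    using abs_sin_x_le_abs_x[of "pi * x"] by (simp add: rotation_size_eq_sin abs_mult)
  also have "\<dots> \<le> 2 * (4 * \<bar>x\<bar>)"
    using pi_less_4 by (intro mult_left_mono mult_right_mono) auto
  finally show ?thesis
    by simp
qed

lemma rotation_size_ge_abs:
  assumes "\<bar>x\<bar> \<le> 1/2"
  shows "\<bar>x\<bar> \<le> rotation_size x"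
proof -
  define y where "y = pi * \<bar>x\<bar>"
  have "pi * \<bar>x\<bar> \<le> 4 * (1/2)"
    using assms pi_less_4 by (intro mult_mono) auto
  then have y: "0 \<le> y" "y \<le> 2"
    by (auto simp: y_def)
  have "\<bar>sin y - y\<bar> \<le> \<bar>y\<bar> ^ 3 / 6"
  proof -
    have "(\<Sum>m<3. sin_coeff m * y ^ m) = y"
      by (simp add: sin_coeff_def eval_nat_numeral)
    moreover have "inverse (fact 3) = (1/6 :: real)"
      by (simp add: fact_numeral)
    ultimately show ?thesis
      using Maclaurin_sin_bound[of y 3] by (simp only: mult.commute[of "1/6"] times_divide_eq_right mult_1_right)
  qed
  moreover have "\<bar>y\<bar> ^ 3 \<le> 4 * y"
    using y mult_mono[OF y(2) y(2)] mult_right_mono[of "y * y" 4 y] by (simp add: power3_eq_cube)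
  ultimately have "y \<le> 3 * sin y"
    using y by linarith
  moreover have "2 * \<bar>x\<bar> \<le> y"
    using pi_ge_two by (simp add: y_def mult_right_mono)
  moreover have "\<bar>sin y\<bar> = \<bar>sin (pi * x)\<bar>"
    by (cases "0 \<le> x") (simp_all add: y_def)
  ultimately show ?thesis
    by (simp add: rotation_size_eq_sin)
qed

definition int_dist :: "real \<Rightarrow> real" where
  "int_dist x = \<bar>x - of_int (round x)\<bar>"

lemma int_dist_le: "int_dist x \<le> \<bar>x - of_int m\<bar>"
  unfolding int_dist_def by (rule round_diff_minimal)

lemma int_dist_le_half: "int_dist x \<le> 1/2"
  unfolding int_dist_def using of_int_round_abs_le[of x] by (simp add: abs_minus_commute)

lemma int_dist_eq: "\<bar>x\<bar> < 1/2 \<Longrightarrow> int_dist x = \<bar>x\<bar>"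
  unfolding int_dist_def by (subst round_unique'[of x 0]) auto

lemma int_dist_diff_int [simp]: "int_dist (x - of_int m) = int_dist x"
proof (rule antisym)
  show "int_dist (x - of_int m) \<le> int_dist x"
    using int_dist_le[of "x - of_int m" "round x - m"] by (simp add: int_dist_def[of x])
  show "int_dist x \<le> int_dist (x - of_int m)"
    using int_dist_le[of x "round (x - of_int m) + m"]
    by (simp add: int_dist_def[of "x - of_int m"] algebra_simps)
qed

lemma int_dist_minus [simp]: "int_dist (- x) = int_dist x"
proof (rule antisym)
  show "int_dist (- x) \<le> int_dist x" for x
    using int_dist_le[of "- x" "- round x"] by (simp add: int_dist_def[of x])
  from this[of "- x"] show "int_dist x \<le> int_dist (- x)"
    by simp
qed

lemma rotation_size_bounds: "int_dist x \<le> rotation_size x" "rotation_size x \<le> 8 * int_dist x"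
  using rotation_size_ge_abs[of "x - of_int (round x)"] rotation_size_le_abs[of "x - of_int (round x)"]
    int_dist_le_half[of x] by (simp_all add: int_dist_def rotation_size_diff_int)

text \<open>
  The tiny numbers \<open>u\<close> and \<open>v\<close> are steps around the circle, whose multiples come close to integers
  simultaneously. After about \<open>1 / u\<close> steps the first walk has run once around the circle, so
  the second has run around about \<open>l\<close> times, for an integer \<open>l\<close>; symmetrically, when the second
  has run around once, the first has done so about \<open>m\<close> times. Hence \<open>l\<close> and \<open>m\<close> approximate the
  reciprocal ratios \<open>v / u\<close> and \<open>u / v\<close>, and \<open>l * m = 1\<close>.
\<close>

lemma comparable_multiples_close:
  fixes u v c :: real
  assumes c: "1 \<le> c" and u: "0 < u" "6 * c ^ 3 * u < 1" and v: "v \<le> c * u" "u \<le> c * v"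
    and uv: "\<And>i::int. int_dist (i * v) \<le> c * int_dist (i * u)"
    and vu: "\<And>i::int. int_dist (i * u) \<le> c * int_dist (i * v)"
  shows "\<bar>v - u\<bar> \<le> 2 * c * u\<^sup>2"
proof -
  have v0: "0 < v"
    using u(1) v(2) c by (smt (verit) mult_nonneg_nonpos)
  have around: "\<exists>i::int. \<bar>1 - i * s\<bar> \<le> s" if "0 < s" for s :: real
  proof -
    have "of_int \<lfloor>1 / s\<rfloor> * s \<le> 1" "1 < (of_int \<lfloor>1 / s\<rfloor> + 1) * s"
      using that pos_le_divide_eq[of s "of_int \<lfloor>1 / s\<rfloor>" 1]
        pos_divide_less_eq[of s 1 "of_int \<lfloor>1 / s\<rfloor> + 1"] floor_correct[of "1 / s"] by simp_all
    then show ?thesis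
      by (intro exI[of _ "\<lfloor>1 / s\<rfloor>"]) (simp add: algebra_simps)
  qed
  have int_near: "int_dist (i * s) \<le> s" if "\<bar>1 - of_int i * s\<bar> \<le> s" for i :: int and s :: real
    using int_dist_le[of "i * s" 1] that by (simp add: abs_minus_commute)
  obtain i :: int where i: "\<bar>1 - i * u\<bar> \<le> u"
    using around[OF u(1)] by blast
  obtain i' :: int where i': "\<bar>1 - i' * v\<bar> \<le> v"
    using around[OF v0] by blast
  define l where "l = round (i * v)"
  define m where "m = round (i' * u)"
  have c2: "c * u \<le> c\<^sup>2 * u" "c\<^sup>2 * u \<le> c ^ 3 * u"
    using c u(1) by (auto simp: power2_eq_square power3_eq_cube)
  have "\<bar>i * v - l\<bar> \<le> c * u"
    using order_trans[OF uv[of i] mult_left_mono[OF int_near[OF i]]] c by (simp add: l_def int_dist_def)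
  moreover have "\<bar>v / u - i * v\<bar> \<le> c * u"
  proof -
    have "v / u - i * v = (v / u) * (1 - i * u)"
      using u(1) by (simp add: field_simps)
    then have "\<bar>v / u - i * v\<bar> = (v / u) * \<bar>1 - i * u\<bar>"
      using u(1) v0 by (simp add: abs_mult)
    also have "\<dots> \<le> c * u"
      using i u(1) v0 v(1) c by (intro mult_mono) (auto simp: field_simps)
    finally show ?thesis .
  qed
  ultimately have l: "\<bar>v / u - l\<bar> \<le> 2 * c * u"
    by linarith
  have "\<bar>i' * u - m\<bar> \<le> c * v"
    using order_trans[OF vu[of i'] mult_left_mono[OF int_near[OF i']]] c by (simp add: m_def int_dist_def)
  moreover have "\<bar>u / v - i' * u\<bar> \<le> c * v"
  proof -
    have "u / v - i' * u = (u / v) * (1 - i' * v)"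
      using v0 by (simp add: field_simps)
    then have "\<bar>u / v - i' * u\<bar> = (u / v) * \<bar>1 - i' * v\<bar>"
      using u(1) v0 by (simp add: abs_mult)
    also have "\<dots> \<le> c * v"
      using i' u(1) v0 v(2) c by (intro mult_mono) (auto simp: field_simps)
    finally show ?thesis .
  qed
  moreover have "c * v \<le> c\<^sup>2 * u"
    using v(1) c by (simp add: power2_eq_square mult.assoc)
  ultimately have m: "\<bar>u / v - m\<bar> \<le> 2 * c\<^sup>2 * u"
    by linarith
  have ratio: "v / u \<le> c" "u / v \<le> c" "0 < v / u" "(v / u) * (u / v) = 1"
    using u(1) v0 v by (auto simp: field_simps)
  have m_le: "\<bar>real_of_int m\<bar> \<le> 2 * c"
  proof -
    have "2 * c\<^sup>2 * u \<le> 1"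
      using c2 u by linarith
    then show ?thesis
      using m ratio(2) divide_pos_pos[OF u(1) v0] c by linarith
  qed
  have prod: "1 - real_of_int (l * m) = (v / u) * (u / v - m) + m * (v / u - l)"
  proof -
    have "1 - L * M = A * (B - M) + M * (A - L)" if "A * B = 1" for A B L M :: real
      using that by (simp add: algebra_simps)
    from this[OF ratio(4)] show ?thesis
      unfolding of_int_mult .
  qed
  have "\<bar>1 - real_of_int (l * m)\<bar> \<le> \<bar>(v / u) * (u / v - m)\<bar> + \<bar>m * (v / u - l)\<bar>"
    unfolding prod by (rule abs_triangle_ineq)
  also have "\<bar>(v / u) * (u / v - m)\<bar> \<le> c * (2 * c\<^sup>2 * u)"
    unfolding abs_mult using ratio(1,3) m c by (intro mult_mono) auto
  also have "\<bar>m * (v / u - l)\<bar> \<le> (2 * c) * (2 * c * u)"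
    unfolding abs_mult using m_le l c by (intro mult_mono) auto
  also have "c * (2 * c\<^sup>2 * u) + (2 * c) * (2 * c * u) = 2 * (c ^ 3 * u) + 4 * (c\<^sup>2 * u)"
    by (simp add: power2_eq_square power3_eq_cube)
  also have "\<dots> < 1"
    using c2 u by linarith
  finally have "\<bar>1 - real_of_int (l * m)\<bar> < 1"
    by simp
  then have "\<bar>real_of_int (1 - l * m)\<bar> < 1"
    by (simp only: of_int_diff of_int_1)
  then have "\<bar>1 - l * m\<bar> < 1"
    by (simp only: of_int_abs[symmetric] of_int_less_1_iff)
  then have "l * m = 1"
    by linarith
  moreover have "0 \<le> l"
  proof -
    have "2 * c * u < 1"
      using c2 u by linarith
    then have "-1 < real_of_int l"
      using l ratio(3) by linarith
    then show ?thesis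
      by linarith
  qed
  ultimately have "l = 1"
    by (auto simp: zmult_eq_1_iff)
  then have "\<bar>v / u - 1\<bar> * u \<le> 2 * c * u * u"
    using l u(1) by (intro mult_right_mono) auto
  moreover have "\<bar>v / u - 1\<bar> * u = \<bar>v - u\<bar>"
  proof -
    have "\<bar>v / u - 1\<bar> * u = \<bar>(v / u - 1) * u\<bar>"
      using u(1) by (simp add: abs_mult)
    then show ?thesis
      using u(1) by (simp add: algebra_simps)
  qed
  ultimately show ?thesis
    by (simp add: power2_eq_square)
qed

text \<open>
  The correspondence \<open>j \<alpha> \<mapsto> j \<beta>\<close> extends to an automorphism of the circle group, and these
  are only the identity and the inversion. In quantitative form: approximating \<open>\<alpha>\<close> by a
  multiple of a small step \<open>j \<alpha> \<equiv> u\<close> transports to \<open>\<beta>\<close> with steps \<open>j \<beta> \<equiv> \<plusminus>u\<close> up to \<open>O(u\<^sup>2)\<close>.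
\<close>

lemma comparable_rotations_imp_eq:
  fixes \<alpha> \<beta> C :: real
  assumes irr: "\<alpha> \<notin> \<rat>" and C: "1 \<le> C"
    and \<beta>\<alpha>: "\<And>j::int. rotation_size (\<beta> * j) \<le> C * rotation_size (\<alpha> * j)"
    and \<alpha>\<beta>: "\<And>j::int. rotation_size (\<alpha> * j) \<le> C * rotation_size (\<beta> * j)"
  shows "\<alpha> - \<beta> \<in> \<int> \<or> \<alpha> + \<beta> \<in> \<int>"
proof -
  define c where "c = 8 * C"
  have c: "1 \<le> c"
    using C by (simp add: c_def)
  have \<beta>_le: "int_dist (\<beta> * j) \<le> c * int_dist (\<alpha> * j)" for j :: int
  proof -
    have "C * rotation_size (\<alpha> * j) \<le> C * (8 * int_dist (\<alpha> * j))"
      using C by (intro mult_left_mono rotation_size_bounds) auto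
    also have "\<dots> = c * int_dist (\<alpha> * j)"
      by (simp add: c_def)
    finally show ?thesis
      using rotation_size_bounds(1)[of "\<beta> * j"] \<beta>\<alpha>[of j] by linarith
  qed
  have \<alpha>_le: "int_dist (\<alpha> * j) \<le> c * int_dist (\<beta> * j)" for j :: int
  proof -
    have "C * rotation_size (\<beta> * j) \<le> C * (8 * int_dist (\<beta> * j))"
      using C by (intro mult_left_mono rotation_size_bounds) auto
    also have "\<dots> = c * int_dist (\<beta> * j)"
      by (simp add: c_def)
    finally show ?thesis
      using rotation_size_bounds(1)[of "\<alpha> * j"] \<alpha>\<beta>[of j] by linarith
  qed
  have approx: "min (int_dist (\<beta> - \<alpha>)) (int_dist (\<beta> + \<alpha>)) \<le> 4 * c * \<eta>"
    if \<eta>: "0 < \<eta>" "6 * c ^ 3 * \<eta> < 1" for \<eta>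
  proof -
    obtain N :: nat where N: "0 < N" "1 / real N < \<eta>"
      using \<eta>(1) by (metis One_nat_def ex_inverse_of_nat_less inverse_eq_divide)
    obtain h j :: int where j: "0 < j" "\<bar>of_int j * \<alpha> - of_int h\<bar> < 1 / N"
      using Dirichlet_approx[OF N(1)] by metis
    define u where "u = of_int j * \<alpha> - of_int h"
    define q where "q = round (\<beta> * j)"
    define v where "v = \<beta> * j - of_int q"
    have u_le: "\<bar>u\<bar> < \<eta>"
      using j N by (simp add: u_def)
    have "of_int j * \<alpha> \<notin> \<int>"
      using rotation_size_pos[OF irr, of j] j(1) rotation_size_eq_0_iff[of "\<alpha> * j"]
      by (auto simp: mult.commute)
    then have u0: "0 < \<bar>u\<bar>"
      by (auto simp: u_def)
    have "c \<le> c ^ 3"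
      using c by (simp add: self_le_power)
    then have "6 * \<eta> \<le> 6 * c ^ 3 * \<eta>"
      using c \<eta>(1) by (intro mult_right_mono) auto
    then have "\<bar>u\<bar> < 1/2"
      using \<eta> u_le by linarith
    then have dist_u: "int_dist (\<alpha> * j) = \<bar>u\<bar>"
      using int_dist_eq[of u] int_dist_diff_int[of "\<alpha> * j" h] by (simp add: u_def mult.commute)
    have dist_v: "int_dist (\<beta> * j) = \<bar>v\<bar>"
      by (simp add: int_dist_def v_def q_def)
    have mult_u: "int_dist (i * \<bar>u\<bar>) = int_dist (\<alpha> * (i * j))" for i :: int
      using int_dist_diff_int[of "\<alpha> * (i * j)" "i * h"] int_dist_minus[of "i * u"]
      by (cases "0 \<le> u") (auto simp: u_def algebra_simps)
    have mult_v: "int_dist (i * \<bar>v\<bar>) = int_dist (\<beta> * (i * j))" for i :: int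
      using int_dist_diff_int[of "\<beta> * (i * j)" "i * q"] int_dist_minus[of "i * v"]
      by (cases "0 \<le> v") (auto simp: v_def algebra_simps)
    have close: "\<bar>\<bar>v\<bar> - \<bar>u\<bar>\<bar> \<le> 2 * c * \<bar>u\<bar>\<^sup>2"
    proof (rule comparable_multiples_close[OF c u0])
      have "6 * c ^ 3 * \<bar>u\<bar> \<le> 6 * c ^ 3 * \<eta>"
        using u_le c by (intro mult_left_mono) auto
      then show "6 * c ^ 3 * \<bar>u\<bar> < 1"
        using \<eta>(2) by linarith
      show "\<bar>v\<bar> \<le> c * \<bar>u\<bar>" "\<bar>u\<bar> \<le> c * \<bar>v\<bar>"
        using \<beta>_le[of j] \<alpha>_le[of j] by (simp_all add: dist_u dist_v)
      show "int_dist (i * \<bar>v\<bar>) \<le> c * int_dist (i * \<bar>u\<bar>)" "int_dist (i * \<bar>u\<bar>) \<le> c * int_dist (i * \<bar>v\<bar>)"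
        for i :: int
        using \<beta>_le[of "i * j"] \<alpha>_le[of "i * j"] by (simp_all add: mult_u mult_v)
    qed
    \<comment> \<open>whether \<open>u\<close> and \<open>v\<close> have the same sign decides between \<open>\<beta> \<equiv> \<alpha>\<close> and \<open>\<beta> \<equiv> -\<alpha>\<close>\<close>
    define \<sigma> :: int where "\<sigma> = (if (0 \<le> u) = (0 \<le> v) then 1 else -1)"
    have \<sigma>: "\<bar>v - \<sigma> * u\<bar> = \<bar>\<bar>v\<bar> - \<bar>u\<bar>\<bar>" "\<bar>real_of_int \<sigma>\<bar> = 1"
      by (auto simp: \<sigma>_def)
    define f where "f = frac \<alpha>"
    have f: "0 \<le> f" "f < 1"
      by (simp_all add: f_def frac_lt_1)
    define i\<^sub>0 where "i\<^sub>0 = \<lfloor>f / \<bar>u\<bar>\<rfloor>"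
    define i where "i = (if 0 \<le> u then i\<^sub>0 else - i\<^sub>0)"
    have i0: "0 \<le> i\<^sub>0" "of_int i\<^sub>0 * \<bar>u\<bar> \<le> f" "f < (of_int i\<^sub>0 + 1) * \<bar>u\<bar>"
      using f u0 pos_le_divide_eq[of "\<bar>u\<bar>" "of_int i\<^sub>0" f]
        pos_divide_less_eq[of "\<bar>u\<bar>" f "of_int i\<^sub>0 + 1"] floor_correct[of "f / \<bar>u\<bar>"]
      by (simp_all add: i\<^sub>0_def)
    have iu: "i * u = i\<^sub>0 * \<bar>u\<bar>" "\<bar>real_of_int i\<bar> = i\<^sub>0"
      using i0(1) by (auto simp: i_def)
    have step: "\<bar>f - i * u\<bar> \<le> \<bar>u\<bar>"
      using i0(2,3) unfolding iu(1) distrib_right mult_1_left abs_le_iff by linarith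
    have "int_dist (\<beta> * (1 - i * j)) \<le> c * int_dist (\<alpha> * (1 - i * j))"
      using \<beta>_le[of "1 - i * j"] by simp
    also have "int_dist (\<alpha> * (1 - i * j)) \<le> \<bar>u\<bar>"
    proof -
      have "\<alpha> * (1 - i * j) - of_int (\<lfloor>\<alpha>\<rfloor> - i * h) = f - i * u"
        by (simp add: f_def frac_def u_def algebra_simps)
      then show ?thesis
        using int_dist_le[of "\<alpha> * (1 - i * j)" "\<lfloor>\<alpha>\<rfloor> - i * h"] step by simp
    qed
    finally have "int_dist (\<beta> * (1 - i * j)) \<le> c * \<bar>u\<bar>"
      using c by (simp add: mult_left_mono)
    then have "\<exists>q'::int. \<bar>\<beta> * (1 - i * j) - q'\<bar> \<le> c * \<bar>u\<bar>"
      unfolding int_dist_def by (rule exI)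
    then obtain q' :: int where q': "\<bar>\<beta> * (1 - i * j) - q'\<bar> \<le> c * \<bar>u\<bar>"
      by (rule exE)
    have drift: "\<bar>i * v - i * (\<sigma> * u)\<bar> \<le> 2 * c * \<bar>u\<bar>"
    proof -
      have "\<bar>i * v - i * (\<sigma> * u)\<bar> = i\<^sub>0 * \<bar>v - \<sigma> * u\<bar>"
        using iu(2) by (simp add: abs_mult flip: right_diff_distrib)
      also have "\<dots> \<le> i\<^sub>0 * (2 * c * \<bar>u\<bar>\<^sup>2)"
        using close i0(1) \<sigma>(1) by (intro mult_left_mono) auto
      also have "\<dots> = (i\<^sub>0 * \<bar>u\<bar>) * (2 * c * \<bar>u\<bar>)"
        by (simp add: power2_eq_square)
      also have "\<dots> \<le> 1 * (2 * c * \<bar>u\<bar>)"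
        using i0(2) f c by (intro mult_right_mono) auto
      finally show ?thesis
        by simp
    qed
    have "\<bar>\<sigma> * (f - i * u)\<bar> \<le> \<bar>u\<bar>"
      using step \<sigma>(2) by (simp add: abs_mult)
    moreover have "\<beta> - \<sigma> * \<alpha> - of_int (q' + i * q - \<sigma> * \<lfloor>\<alpha>\<rfloor>)
        = (\<beta> * (1 - i * j) - q') + (i * v - i * (\<sigma> * u)) - \<sigma> * (f - i * u)"
      by (simp add: v_def f_def frac_def algebra_simps)
    ultimately have "\<bar>\<beta> - \<sigma> * \<alpha> - of_int (q' + i * q - \<sigma> * \<lfloor>\<alpha>\<rfloor>)\<bar> \<le> 3 * c * \<bar>u\<bar> + \<bar>u\<bar>"
      using q' drift by linarith
    also have "\<dots> \<le> 4 * c * \<bar>u\<bar>"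
      using c u0 mult_right_mono[of 1 c "\<bar>u\<bar>"] by simp
    also have "\<dots> \<le> 4 * c * \<eta>"
      using u_le c by (intro mult_left_mono) auto
    finally have "int_dist (\<beta> - \<sigma> * \<alpha>) \<le> 4 * c * \<eta>"
      by (rule order_trans[OF int_dist_le])
    then show ?thesis
      by (auto simp: \<sigma>_def split: if_splits)
  qed
  have "min (int_dist (\<beta> - \<alpha>)) (int_dist (\<beta> + \<alpha>)) \<le> 0"
  proof (rule ccontr)
    assume "\<not> ?thesis"
    then have "0 < min (int_dist (\<beta> - \<alpha>)) (int_dist (\<beta> + \<alpha>))"
      by (simp only: not_le)
    from dense[OF this]
    obtain r where r: "0 < r" "r < min (int_dist (\<beta> - \<alpha>)) (int_dist (\<beta> + \<alpha>))"
      by (elim exE conjE)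
    define \<eta> where "\<eta> = min (1 / (7 * c ^ 3)) (r / (4 * c))"
    have "0 < c ^ 3"
      using c by simp
    have "6 * c ^ 3 * \<eta> \<le> 6 * c ^ 3 * (1 / (7 * c ^ 3))"
      using c by (intro mult_left_mono) (auto simp: \<eta>_def)
    also have "\<dots> < 1"
      using \<open>0 < c ^ 3\<close> by (simp add: field_simps)
    finally have "min (int_dist (\<beta> - \<alpha>)) (int_dist (\<beta> + \<alpha>)) \<le> 4 * c * \<eta>"
      using r(1) c by (intro approx) (auto simp: \<eta>_def)
    also have "\<dots> \<le> 4 * c * (r / (4 * c))"
      using c by (intro mult_left_mono) (auto simp: \<eta>_def)
    also have "\<dots> = r"
      using c by simp
    finally show False
      using r(2) by linarith
  qed
  then have "\<beta> - \<alpha> \<in> \<int> \<or> \<beta> + \<alpha> \<in> \<int>"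
    unfolding min_le_iff_disj int_dist_def by (metis Ints_of_int abs_le_zero_iff eq_iff_diff_eq_0)
  then show ?thesis
    using Ints_minus[of "\<beta> - \<alpha>"] by (auto simp: add.commute)
qed

section \<open>Cones around the axis\<close>

definition axis_cone :: "real \<Rightarrow> real \<Rightarrow> point set" where
  "axis_cone a b = {x. a * cmod (fst x) + b < height x}"

lemma open_axis_cone: "open (axis_cone a b)"
  unfolding axis_cone_def by (intro open_Collect_less continuous_intros)

lemma convex_axis_cone: "0 \<le> a \<Longrightarrow> convex (axis_cone a b)"
proof (rule convexI)
  fix x y :: point and u v :: real
  assume a: "0 \<le> a" and xy: "x \<in> axis_cone a b" "y \<in> axis_cone a b" and uv: "0 \<le> u" "0 \<le> v" "u + v = 1"
  have "a * cmod (fst (u *\<^sub>R x + v *\<^sub>R y)) + b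
      \<le> a * (u * cmod (fst x) + v * cmod (fst y)) + b"
    using a uv norm_triangle_ineq[of "u *\<^sub>R fst x" "v *\<^sub>R fst y"]
    by (intro add_right_mono mult_left_mono) simp_all
  also have "\<dots> = u * (a * cmod (fst x) + b) + v * (a * cmod (fst y) + b)"
    using arg_cong[OF uv(3), of "\<lambda>s. s * b"] by (simp add: algebra_simps)
  also have "\<dots> < u * height x + v * height y"
  proof (cases "u = 0")
    case False
    then show ?thesis
      using xy uv by (intro add_less_le_mono mult_strict_left_mono mult_left_mono) (auto simp: axis_cone_def)
  qed (use xy uv in \<open>auto simp: axis_cone_def\<close>)
  finally show "u *\<^sub>R x + v *\<^sub>R y \<in> axis_cone a b"
    by (simp add: axis_cone_def height_def)
qed

lemma axis_cone_H4:
  assumes "0 \<le> a" "0 \<le> b"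
  shows "axis_cone a b \<subseteq> H4"
proof
  fix x :: point assume "x \<in> axis_cone a b"
  moreover have "0 \<le> a * cmod (fst x)"
    using assms by simp
  ultimately show "x \<in> H4"
    using assms(2) unfolding axis_cone_def mem_H4_iff mem_Collect_eq by linarith
qed

lemma screw_power_mem_axis_cone [simp]: "screw_power \<gamma> j x \<in> axis_cone a b \<longleftrightarrow> x \<in> axis_cone a b"
  by (simp add: axis_cone_def)

text \<open>
  By Dirichlet's theorem some power of the screw rotates by an angle as small as desired, so
  the Margulis region contains cones of arbitrarily small slope: the height of its boundary
  grows sublinearly with the distance from the axis.
\<close>

lemma axis_cone_subset_margulis_region:
  assumes "0 < \<epsilon>" "0 < a"
  obtains b where "0 \<le> b" "axis_cone a b \<subseteq> margulis_region \<epsilon> \<gamma>"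
proof -
  have "0 < \<epsilon> * a / 8"
    using assms by simp
  then obtain N :: nat where N: "0 < N" "1 / real N < \<epsilon> * a / 8"
    by (metis One_nat_def ex_inverse_of_nat_less inverse_eq_divide)
  obtain h j :: int where j: "0 < j" "\<bar>of_int j * \<gamma> - of_int h\<bar> < 1 / N"
    using Dirichlet_approx[OF N(1)] by metis
  have "rotation_size (\<gamma> * j) = rotation_size (of_int j * \<gamma> - of_int h)"
    by (simp add: rotation_size_diff_int mult.commute)
  also have "\<dots> \<le> 8 * \<bar>of_int j * \<gamma> - of_int h\<bar>"
    by (rule rotation_size_le_abs)
  also have "\<dots> \<le> 8 * (\<epsilon> * a / 8)"
    using less_trans[OF j(2) N(2)] by (intro mult_left_mono) auto
  finally have rot: "rotation_size (\<gamma> * j) \<le> \<epsilon> * a"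
    by simp
  \<comment> \<open>the slope absorbs the rotation part of the \<open>j\<close>-th power, the offset its translation part\<close>
  have "x \<in> margulis_region \<epsilon> \<gamma>" if x: "x \<in> axis_cone a (j / \<epsilon>)" for x
  proof -
    have H: "x \<in> H4"
      using x axis_cone_H4[of a "j / \<epsilon>"] assms j(1) by auto
    have "dist (screw_power \<gamma> j x) x \<le> j + (\<epsilon> * a) * cmod (fst x)"
      using displacement_le[of x \<gamma> j] mult_right_mono[OF rot, of "cmod (fst x)"] j(1)
      by (simp add: dist_commute)
    also have "\<dots> = \<epsilon> * (a * cmod (fst x) + j / \<epsilon>)"
      using assms by (simp add: algebra_simps)
    also have "\<dots> < \<epsilon> * height x"
      using x assms by (simp add: axis_cone_def)
    finally have "(dist (screw_power \<gamma> j x) x)\<^sup>2 < (\<epsilon> * height x)\<^sup>2"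
      by (intro power_strict_mono) auto
    also have "\<dots> = 2 * height x * height x * (\<epsilon>\<^sup>2 / 2)"
      by (simp add: power2_eq_square)
    also have "\<dots> \<le> 2 * height x * height x * (cosh \<epsilon> - 1)"
      by (intro mult_left_mono cosh_minus_one_ge) auto
    finally have "hyp_dist (screw_power \<gamma> j x) x < \<epsilon>"
      using H assms by (simp add: hyp_dist_less_iff)
    then show ?thesis
      using H j(1) unfolding margulis_region_iff by (intro conjI exI[of _ "nat j"]) auto
  qed
  then have "axis_cone a (j / \<epsilon>) \<subseteq> margulis_region \<epsilon> \<gamma>"
    by blast
  then show ?thesis
    using assms j(1) by (intro that[of "j / \<epsilon>"]) auto
qed

lemma height_on_horizontal_segment:
  assumes "height u = c" "height v = c" "p \<in> closed_segment u v"
  shows "height p = c"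
proof -
  obtain s where "p = (1 - s) *\<^sub>R u + s *\<^sub>R v"
    using assms(3) by (auto simp: closed_segment_def)
  then have "height p = (1 - s) * height u + s * height v"
    by (simp add: height_def)
  then show ?thesis
    by (simp add: assms(1,2) left_diff_distrib)
qed

definition axis_point :: "real \<Rightarrow> point" where
  "axis_point t = (0, 0, t)"

text \<open>
  The constants are chosen in this order: the radius \<open>L\<close> is large in terms of \<open>\<epsilon>\<close> and the
  Lipschitz constant \<open>k\<close>, and the slope \<open>a\<close> is so small that the hyperbolic ball of radius
  \<open>k * L\<close> around a high point of the axis lies in the cone.
\<close>

locale cone_embedding = lifted_embedding \<alpha> \<beta> k "axis_cone a b" \<Phi> n
  for \<alpha> \<beta> k a b \<Phi> n +
  fixes \<epsilon> L :: real
  assumes \<epsilon>: "0 < \<epsilon>" "\<epsilon> \<le> L" and b: "0 \<le> b" and a: "a = 1 / (8 * (cosh (k * L))\<^sup>2)"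
    and L_large: "(3 + 3 * (2 * k * exp (4 * k)))\<^sup>2 * exp (4 * k) < 2 * (cosh L - 1)"
    and region: "\<Phi> ` axis_cone a b \<subseteq> margulis_region \<epsilon> \<beta>"
    and irrational: "\<alpha> \<notin> \<rat>" "\<beta> \<notin> \<rat>"
begin

abbreviation "C \<equiv> cosh (k * L)"

lemma L_pos: "0 < L"
  using \<epsilon> by linarith

lemma C_ge_1: "1 \<le> C"
  by (rule cosh_real_ge_1)

lemma a_bounds: "0 < a" "a \<le> 1 / 8" "a * (8 * C\<^sup>2) = 1"
proof -
  have "1 \<le> C\<^sup>2"
    using C_ge_1 by (simp add: one_le_power)
  then show "0 < a" "a \<le> 1 / 8" "a * (8 * C\<^sup>2) = 1"
    by (auto simp: a field_simps)
qed

lemma axis_mem: "4 * C * b < t \<Longrightarrow> axis_point t \<in> axis_cone a b"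
  using mult_right_mono[OF C_ge_1 b] b by (simp add: axis_point_def axis_cone_def)

text \<open>
  The compact set \<open>K\<close> is the closed hyperbolic ball of radius \<open>k * L\<close>. In it the height is at least
  \<open>t / (2 * C)\<close> and the distance from the axis at most \<open>2 * C * t\<close>, which explains the choice of
  the slope.
\<close>

lemma axis_ball:
  assumes t: "4 * C * b < t"
  shows "hyp_ball (\<Phi> (axis_point t)) L \<subseteq> \<Phi> ` axis_cone a b"
proof (rule ball_subset_image)
  define K where "K = {x. (dist (axis_point t) x)\<^sup>2 \<le> 2 * t * height x * (C - 1)}"
  have t0: "0 < t"
    using t b C_ge_1 by (smt (verit) mult_nonneg_nonneg)
  have axis_H4: "axis_point t \<in> H4"
    using t0 by (simp add: axis_point_def mem_H4_iff)
  have K_H4: "x \<in> H4" if x: "x \<in> K" for x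
  proof (rule ccontr)
    assume "x \<notin> H4"
    then have "height x \<le> 0"
      by (simp add: mem_H4_iff)
    then have "2 * t * height x * (C - 1) \<le> 0"
      using t0 C_ge_1 by (simp add: mult_nonneg_nonpos mult_nonpos_nonneg)
    then have "(dist (axis_point t) x)\<^sup>2 \<le> 0"
      using x unfolding K_def mem_Collect_eq by (rule order_trans[rotated])
    then have "x = axis_point t"
      by simp
    then show False
      using \<open>x \<notin> H4\<close> axis_H4 by simp
  qed
  have K_dist: "dist (axis_point t) x \<le> 2 * C * t" "t \<le> 2 * C * height x" if x: "x \<in> K" for x
    using dist_le_height[OF axis_H4 K_H4[OF x] C_ge_1] height_ratio_le[OF K_H4[OF x] axis_H4, of C] x
    by (simp_all add: K_def axis_point_def dist_commute mult_ac)
  show "compact K"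
  proof (rule compact_eq_bounded_closed[THEN iffD2], intro conjI)
    show "bounded K"
      using K_dist(1) unfolding bounded_def by blast
    show "closed K"
      unfolding K_def by (intro closed_Collect_le continuous_intros)
  qed
  show "K \<subseteq> axis_cone a b"
  proof
    fix x assume x: "x \<in> K"
    have "cmod (fst x) \<le> 2 * C * t"
      using dist_components_le(1)[of "axis_point t" x] K_dist(1)[OF x] by (simp add: axis_point_def)
    then have "(4 * C) * (a * cmod (fst x)) \<le> (4 * C) * (a * (2 * C * t))"
      using a_bounds C_ge_1 by (intro mult_left_mono) auto
    also have "\<dots> = (a * (8 * C\<^sup>2)) * t"
      by (simp add: power2_eq_square)
    also have "\<dots> = t"
      by (simp add: a_bounds)
    finally have "(4 * C) * (a * cmod (fst x) + b) < 2 * t"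
      using t by (simp add: distrib_left)
    also have "\<dots> \<le> (4 * C) * height x"
      using mult_left_mono[OF K_dist(2)[OF x], of 2] by (simp add: mult_ac)
    finally show "x \<in> axis_cone a b"
      using C_ge_1 by (simp add: axis_cone_def)
  qed
  show "x \<in> K" if "x \<in> H4" "hyp_dist (axis_point t) x < k * L" for x
    using that axis_H4 by (simp add: hyp_dist_less_iff K_def axis_point_def)
  show "axis_point t \<in> axis_cone a b"
    using t by (rule axis_mem)
qed

text \<open>
  The image point lies in the Margulis region, so a nontrivial power of the screw moves it by
  less than \<open>\<epsilon> \<le> L\<close>. Both the point and its translate lie in \<open>\<Phi> ` D\<close>, and for \<open>n = 0\<close>
  this set would be disjoint from all its translates.
\<close>

lemma n_nonzero: "n \<noteq> 0"
proof -
  define t where "t = 4 * C * b + 1"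
  have t: "4 * C * b < t"
    by (simp add: t_def)
  obtain j :: nat where j: "1 \<le> j" "hyp_dist (screw_power \<beta> (int j) (\<Phi> (axis_point t))) (\<Phi> (axis_point t)) < \<epsilon>"
    using region axis_mem[OF t] unfolding margulis_region_iff image_subset_iff by blast
  then have "screw_power \<beta> (int j) (\<Phi> (axis_point t)) \<in> hyp_ball (\<Phi> (axis_point t)) L"
    using \<epsilon> \<Phi>_H4 axis_mem[OF t] by (auto simp: hyp_ball_def hyp_dist_sym)
  then obtain x where "x \<in> axis_cone a b" "\<Phi> x = screw_power \<beta> (int j) (\<Phi> (axis_point t))"
    using axis_ball[OF t] by (metis imageE subsetD)
  then obtain m where "int j = n * m"
    using orbit_injective[OF axis_mem[OF t]] by blast
  then show ?thesis
    using j(1) by auto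
qed

text \<open>
  Far up the axis the screw moves a point by very little, so its image is moved by very little
  by the \<open>n\<close>-th power. As this power has a nontrivial translation and a nontrivial rotation
  part, the image is high up and, at the scale of its height, close to the axis.
\<close>

lemma axis_image_near_axis:
  assumes \<delta>: "0 < \<delta>"
  shows "\<forall>\<^sub>F t in at_top. axis_point t \<in> axis_cone a b \<and> hyp_ball (\<Phi> (axis_point t)) L \<subseteq> \<Phi> ` axis_cone a b \<and>
    1 \<le> \<delta> * height (\<Phi> (axis_point t)) \<and> cmod (fst (\<Phi> (axis_point t))) \<le> \<delta> * height (\<Phi> (axis_point t))"
proof -
  define r where "r = rotation_size (\<beta> * n)"
  have r: "0 < r"
    unfolding r_def using irrational(2) n_nonzero by (rule rotation_size_pos)
  have "((\<lambda>t::real. 2 * k / t * exp (2 * (2 * k / t))) \<longlongrightarrow> 0 * exp (2 * 0)) at_top"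
    by (intro tendsto_intros real_tendsto_divide_at_top[OF tendsto_const filterlim_ident])
  then have "\<forall>\<^sub>F t in at_top. 2 * k / t * exp (2 * (2 * k / t)) < min \<delta> (\<delta> * r)"
    using \<delta> r by (intro order_tendstoD) auto
  moreover have "\<forall>\<^sub>F t::real in at_top. 4 * C * b < t" "\<forall>\<^sub>F t::real in at_top. 0 < t"
    by (rule eventually_gt_at_top)+
  ultimately show ?thesis
  proof eventually_elim
    case (elim t)
    define y where "y = \<Phi> (axis_point t)"
    have x: "axis_point t \<in> axis_cone a b"
      using elim by (intro axis_mem)
    then have y: "0 < height y"
      using \<Phi>_H4 by (auto simp: y_def mem_H4_iff)
    have "dist (axis_point t) (screw_power \<alpha> 1 (axis_point t)) = 1"
      by (simp add: axis_point_def screw_power_simp dist_prod_def dist_real_def)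
    moreover have "closed_segment (axis_point t) (screw_power \<alpha> 1 (axis_point t)) \<subseteq> axis_cone a b"
      using x a_bounds by (intro closed_segment_subset convex_axis_cone) auto
    moreover have "t \<le> height p" if "p \<in> closed_segment (axis_point t) (screw_power \<alpha> 1 (axis_point t))" for p
      using height_on_horizontal_segment[OF _ _ that] by (simp add: axis_point_def)
    ultimately have "dist y (\<Phi> (screw_power \<alpha> 1 (axis_point t))) \<le> 2 * k / t * exp (2 * (2 * k / t)) * height y"
      unfolding y_def using elim by (intro image_along_segment(2)) auto
    also have "\<dots> \<le> min \<delta> (\<delta> * r) * height y"
      using elim y by (intro mult_right_mono) auto
    finally have d: "dist y (screw_power \<beta> n y) \<le> min \<delta> (\<delta> * r) * height y"
      using equivariant[OF x, of 1] by (simp add: y_def)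
    have "1 \<le> \<bar>real_of_int n\<bar>"
      using n_nonzero by (simp flip: of_int_abs)
    also have "\<dots> \<le> min \<delta> (\<delta> * r) * height y"
      using displacement_ge_int d by (rule order_trans)
    also have "\<dots> \<le> \<delta> * height y"
      using y by (intro mult_right_mono) auto
    finally have 1: "1 \<le> \<delta> * height y" .
    have "r * cmod (fst y) \<le> min \<delta> (\<delta> * r) * height y"
      unfolding r_def using displacement_ge_rotation d[unfolded r_def] by (rule order_trans)
    also have "\<dots> \<le> (\<delta> * r) * height y"
      using y by (intro mult_right_mono) auto
    finally have "r * cmod (fst y) \<le> r * (\<delta> * height y)"
      by (simp add: mult_ac)
    then have "cmod (fst y) \<le> \<delta> * height y"
      using r by simp
    then show ?case
      using 1 x axis_ball elim by (simp add: y_def)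
  qed
qed

lemma L_large': "9 < 2 * (cosh L - 1)"
proof -
  have "3\<^sup>2 * 1 \<le> (3 + 3 * (2 * k * exp (4 * k)))\<^sup>2 * exp (4 * k)"
    using k by (intro mult_mono power_mono) auto
  then show ?thesis
    using L_large by simp
qed

text \<open>
  Near the axis the generating screw itself moves points by less than \<open>L\<close>, so the translate
  lies again in \<open>\<Phi> ` D\<close>, which forces \<open>n\<close> to divide one.
\<close>

lemma abs_n_eq_1: "\<bar>n\<bar> = 1"
proof -
  obtain t where "axis_point t \<in> axis_cone a b" "hyp_ball (\<Phi> (axis_point t)) L \<subseteq> \<Phi> ` axis_cone a b"
    and near: "1 \<le> 1/3 * height (\<Phi> (axis_point t))" "cmod (fst (\<Phi> (axis_point t))) \<le> 1/3 * height (\<Phi> (axis_point t))"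
    using eventually_happens'[OF _ axis_image_near_axis[of "1/3"]] by auto
  define y where "y = \<Phi> (axis_point t)"
  have y: "y \<in> H4" "0 < height y"
    using \<Phi>_H4 \<open>axis_point t \<in> axis_cone a b\<close> by (auto simp: y_def mem_H4_iff)
  have "dist y (screw_power \<beta> 1 y) \<le> 1 + 2 * cmod (fst y)"
    using displacement_le[of y \<beta> 1] mult_right_mono[OF rotation_size_le_2, of "cmod (fst y)" \<beta>] by simp
  also have "\<dots> \<le> height y"
    using near by (simp add: y_def)
  finally have "(dist y (screw_power \<beta> 1 y))\<^sup>2 \<le> (height y)\<^sup>2"
    by (intro power_mono) auto
  also have "\<dots> < 2 * height y * height y * (cosh L - 1)"
    using y L_large' by (simp add: power2_eq_square)
  finally have "screw_power \<beta> 1 y \<in> hyp_ball y L"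
    using y L_pos by (simp add: hyp_ball_def hyp_dist_less_iff)
  then obtain x where "x \<in> axis_cone a b" "\<Phi> x = screw_power \<beta> 1 (\<Phi> (axis_point t))"
    using \<open>hyp_ball (\<Phi> (axis_point t)) L \<subseteq> \<Phi> ` axis_cone a b\<close> unfolding y_def by (metis imageE subsetD)
  then obtain m where "1 = n * m"
    using orbit_injective[OF \<open>axis_point t \<in> axis_cone a b\<close>] by blast
  then show ?thesis
    using zmult_eq_1_iff[of n m] by auto
qed

text \<open>
  At a point whose distance from the axis is comparable with its height, a power of the screw
  with negligible translation part moves by about its rotation size. For the upper bound such a
  point is taken in the target, inside the ball covered by the image: its preimage has bounded
  slope, and the estimate is transported from the source.
\<close>

lemma rotation_size_image_le:
  obtains B where "\<And>j. j \<noteq> 0 \<Longrightarrow> rotation_size (\<beta> * of_int (n * j)) \<le> B * rotation_size (\<alpha> * of_int j)"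
proof -
  define q where "q = 2 * k * (1 + 4 * C\<^sup>2)"
  have q: "0 \<le> q"
    using k by (simp add: q_def)
  have "rotation_size (\<beta> * of_int (n * j)) \<le> 2 * q * exp (4 * q) * rotation_size (\<alpha> * of_int j)"
    if "j \<noteq> 0" for j
  proof -
    define s where "s = rotation_size (\<alpha> * of_int j)"
    have s: "0 < s" "s \<le> 2"
      unfolding s_def using irrational(1) that rotation_size_le_2 by (auto intro: rotation_size_pos)
    have "\<forall>\<^sub>F t in at_top. 2 * C * \<bar>of_int j\<bar> / s < t \<and> 0 < t"
      by (intro eventually_conj eventually_gt_at_top)
    with axis_image_near_axis[of "1/2", simplified] have "\<forall>\<^sub>F t in at_top. (axis_point t \<in> axis_cone a b \<and>
        hyp_ball (\<Phi> (axis_point t)) L \<subseteq> \<Phi> ` axis_cone a b \<and> 2 \<le> height (\<Phi> (axis_point t)) \<and>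
        cmod (fst (\<Phi> (axis_point t))) * 2 \<le> height (\<Phi> (axis_point t))) \<and>
        2 * C * \<bar>of_int j\<bar> / s < t \<and> 0 < t"
      by (rule eventually_conj)
    from eventually_happens'[OF trivial_limit_at_top_linorder this]
    obtain t where t: "2 * C * \<bar>of_int j\<bar> / s < t" "0 < t" and x0: "axis_point t \<in> axis_cone a b"
      and covered: "hyp_ball (\<Phi> (axis_point t)) L \<subseteq> \<Phi> ` axis_cone a b"
      and near: "cmod (fst (\<Phi> (axis_point t))) * 2 \<le> height (\<Phi> (axis_point t))"
      by blast
    define y0 where "y0 = \<Phi> (axis_point t)"
    have y0: "y0 \<in> H4" "0 < height y0"
      using \<Phi>_H4 x0 by (auto simp: y0_def mem_H4_iff)
    \<comment> \<open>its distance from the axis is comparable with its height, since \<open>y0\<close> is close to the axis\<close>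
    define y :: point where "y = y0 + (of_real (height y0), 0, 0)"
    have y_height: "height y = height y0"
      by (simp add: y_def height_def)
    have "dist y0 y = height y0"
      using y0(2) by (simp add: y_def dist_norm norm_prod_def)
    then have y_ball: "y \<in> hyp_ball y0 L"
      using y0 L_pos L_large' y_height
      by (simp add: hyp_ball_def hyp_dist_less_iff mem_H4_iff power2_eq_square)
    then obtain x where x: "x \<in> axis_cone a b" "\<Phi> x = y"
      using covered unfolding y0_def by (metis imageE subsetD)
    have xH: "x \<in> H4" "axis_point t \<in> H4"
      using x x0 D_H4 by auto
    have "hyp_dist (\<Phi> (axis_point t)) (screw_power \<beta> 0 (\<Phi> x)) < L"
      using y_ball x(2) by (simp add: hyp_ball_def y0_def)
    then obtain m where "hyp_dist (axis_point t) (screw_power \<alpha> m x) < k * L"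
      using lower[OF x0 x(1)] by blast
    then have m: "(dist (axis_point t) (screw_power \<alpha> m x))\<^sup>2 \<le> 2 * height (axis_point t) * height x * (C - 1)"
      using xH by (simp add: hyp_dist_less_iff)
    have t_le: "t \<le> 2 * C * height x"
      using height_ratio_le[of "screw_power \<alpha> m x" "axis_point t" C] m xH
      by (simp add: dist_commute mult_ac axis_point_def)
    have "cmod (fst x) \<le> dist (axis_point t) (screw_power \<alpha> m x)"
      using dist_components_le(1)[of "axis_point t" "screw_power \<alpha> m x"] by (simp add: axis_point_def)
    also have "\<dots> \<le> 2 * C * t"
      using dist_le_height[of "axis_point t" "screw_power \<alpha> m x" C] m xH C_ge_1 by (simp add: axis_point_def)
    also have "\<dots> \<le> 2 * C * (2 * C * height x)"
      using t_le C_ge_1 by (intro mult_left_mono) auto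
    finally have slope: "cmod (fst x) \<le> 4 * C\<^sup>2 * height x"
      by (simp add: power2_eq_square)
    \<comment> \<open>\<open>t\<close> was chosen so that the translation by \<open>j\<close> is dominated by the rotation\<close>
    have "2 * C * \<bar>of_int j\<bar> \<le> t * s"
      using t(1) s(1) by (simp add: field_simps)
    also have "\<dots> \<le> (2 * C * height x) * s"
      using t_le s(1) by (intro mult_right_mono) auto
    finally have "\<bar>of_int j\<bar> \<le> height x * s"
      using C_ge_1 by simp
    then have "dist x (screw_power \<alpha> j x) \<le> height x * s + s * (4 * C\<^sup>2 * height x)"
      using displacement_le[of x \<alpha> j] mult_left_mono[OF slope less_imp_le[OF s(1)]]
      by (simp add: s_def)
    then have "2 * k * dist x (screw_power \<alpha> j x) \<le> 2 * k * (height x * s + s * (4 * C\<^sup>2 * height x))"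
      using k by (intro mult_left_mono) auto
    also have "\<dots> = (q * s) * height x"
      by (simp add: q_def algebra_simps)
    finally have M: "2 * k * dist x (screw_power \<alpha> j x) / height x \<le> q * s"
      using xH(1) by (simp add: mem_H4_iff pos_divide_le_eq)
    have "dist (\<Phi> x) (\<Phi> (screw_power \<alpha> j x)) \<le> (q * s) * exp (2 * (q * s)) * height (\<Phi> x)"
    proof (rule image_along_segment(2)[OF _ _ _ M])
      show "closed_segment x (screw_power \<alpha> j x) \<subseteq> axis_cone a b"
        using x a_bounds by (intro closed_segment_subset convex_axis_cone) auto
      show "height x \<le> height p" if "p \<in> closed_segment x (screw_power \<alpha> j x)" for p
        using height_on_horizontal_segment[OF _ _ that] by simp
    qed (use xH in \<open>simp add: mem_H4_iff\<close>)
    then have d: "dist y (screw_power \<beta> (n * j) y) \<le> (q * s) * exp (2 * (q * s)) * height y0"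
      using equivariant[OF x(1)] by (simp add: x(2) y_height)
    have "height y0 / 2 \<le> cmod (fst y)"
      using near y0(2) norm_diff_ineq[of "of_real (height y0)" "fst y0"]
      by (simp add: y_def add.commute flip: y0_def)
    then have "rotation_size (\<beta> * of_int (n * j)) * (height y0 / 2)
        \<le> rotation_size (\<beta> * of_int (n * j)) * cmod (fst y)"
      by (intro mult_left_mono) auto
    also have "\<dots> \<le> (q * s) * exp (2 * (q * s)) * height y0"
      using displacement_ge_rotation d by (rule order_trans)
    finally have "rotation_size (\<beta> * of_int (n * j)) * height y0 \<le> (2 * q * exp (2 * (q * s)) * s) * height y0"
      by (simp add: algebra_simps)
    then have "rotation_size (\<beta> * of_int (n * j)) \<le> 2 * q * exp (2 * (q * s)) * s"
      using y0(2) by (rule mult_right_le_imp_le)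
    also have "\<dots> \<le> 2 * q * exp (4 * q) * s"
      using s q mult_left_mono[OF s(2) q] by (intro mult_right_mono mult_left_mono) auto
    finally show ?thesis
      by (simp add: s_def)
  qed
  then show ?thesis
    using that by blast
qed

text \<open>
  For the converse bound the point is taken in the source, at distance \<open>t\<close> from the axis
  and at height \<open>t\<close>. Its image and the translates of the image stay in the ball covered by
  \<open>\<Phi>\<close>, where the inverse map can be integrated along the horizontal segment joining them.
\<close>

lemma rotation_size_le_image:
  obtains B where "\<And>j. j \<noteq> 0 \<Longrightarrow> rotation_size (\<alpha> * of_int j) \<le> B * rotation_size (\<beta> * of_int (n * j))"
proof -
  define E where "E = exp (4 * k)"
  define Q where "Q = 2 * k * E"
  have E: "1 \<le> E" and Q: "0 \<le> Q"
    using k by (auto simp: E_def Q_def)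
  have L_large_Q: "(3 + 3 * Q)\<^sup>2 * E < 2 * (cosh L - 1)"
    using L_large by (simp add: E_def Q_def)
  define q where "q = 2 * k * (2 + Q) * E"
  have q: "0 \<le> q"
    using k E Q by (simp add: q_def)
  have "rotation_size (\<alpha> * of_int j) \<le> q * exp (4 * q) * rotation_size (\<beta> * of_int (n * j))"
    if "j \<noteq> 0" for j
  proof -
    define s where "s = rotation_size (\<beta> * of_int (n * j))"
    have s: "0 < s" "s \<le> 2"
      unfolding s_def using irrational(2) that n_nonzero rotation_size_le_2
      by (auto intro!: rotation_size_pos simp del: of_int_mult)
    \<comment> \<open>with this \<open>\<delta>\<close> the image point is so high that the translation by \<open>n * j\<close> is dominated by
      the rotation, and also by the height\<close>
    define \<delta> where "\<delta> = min 1 (min 1 s / \<bar>real_of_int (n * j)\<bar>)"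
    have nj: "0 < \<bar>real_of_int (n * j)\<bar>"
      using that n_nonzero by simp
    then have \<delta>: "0 < \<delta>" "\<delta> \<le> 1" "\<bar>real_of_int (n * j)\<bar> * \<delta> \<le> min 1 s"
      using s(1) by (auto simp: \<delta>_def min_def field_simps)
    have "\<forall>\<^sub>F t in at_top. 2 * b < t \<and> 0 < t"
      by (intro eventually_conj eventually_gt_at_top)
    with axis_image_near_axis[OF \<delta>(1)] have "\<forall>\<^sub>F t in at_top. (axis_point t \<in> axis_cone a b \<and>
        hyp_ball (\<Phi> (axis_point t)) L \<subseteq> \<Phi> ` axis_cone a b \<and> 1 \<le> \<delta> * height (\<Phi> (axis_point t)) \<and>
        cmod (fst (\<Phi> (axis_point t))) \<le> \<delta> * height (\<Phi> (axis_point t))) \<and> 2 * b < t \<and> 0 < t"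
      by (rule eventually_conj)
    from eventually_happens'[OF trivial_limit_at_top_linorder this]
    obtain t where t: "2 * b < t" "0 < t" and x0: "axis_point t \<in> axis_cone a b"
      and covered: "hyp_ball (\<Phi> (axis_point t)) L \<subseteq> \<Phi> ` axis_cone a b"
      and near: "1 \<le> \<delta> * height (\<Phi> (axis_point t))" "cmod (fst (\<Phi> (axis_point t))) \<le> \<delta> * height (\<Phi> (axis_point t))"
      by blast
    define x1 :: point where "x1 = (of_real t, 0, t)"
    have "a * t \<le> 1/8 * t"
      using a_bounds t by (intro mult_right_mono) auto
    then have "a * t + b < t"
      using t by linarith
    then have x1: "x1 \<in> axis_cone a b"
      using t by (simp add: x1_def axis_cone_def)
    define y0 where "y0 = \<Phi> (axis_point t)"
    define y1 where "y1 = \<Phi> x1"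
    define y2 where "y2 = screw_power \<beta> (n * j) y1"
    define \<tau> where "\<tau> = height y0"
    have H: "y0 \<in> H4" "y1 \<in> H4" "y2 \<in> H4" and pos: "0 < \<tau>" "0 < height y1"
      using \<Phi>_H4 x0 x1 by (auto simp: y0_def y1_def y2_def \<tau>_def mem_H4_iff image_subset_iff)
    have seg_x: "closed_segment (axis_point t) x1 \<subseteq> axis_cone a b"
      using x0 x1 a_bounds by (intro closed_segment_subset convex_axis_cone) auto
    have "dist (axis_point t) x1 = t"
      using t by (simp add: axis_point_def x1_def dist_prod_def dist_norm)
    then have M: "2 * k * dist (axis_point t) x1 / t \<le> 2 * k"
      using t by simp
    have t_le: "t \<le> height p" if "p \<in> closed_segment (axis_point t) x1" for p
      using height_on_horizontal_segment[OF _ _ that] by (simp add: axis_point_def x1_def)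
    have h1: "\<tau> \<le> E * height y1" and d01: "dist y0 y1 \<le> Q * \<tau>"
      using image_along_segment[OF seg_x t(2) t_le M]
      by (simp_all add: y0_def y1_def \<tau>_def E_def Q_def)
    have "\<delta> * \<tau> \<le> \<tau>"
      using \<delta> pos by (simp add: mult_left_le_one_le)
    then have w1: "cmod (fst y1) \<le> (1 + Q) * \<tau>"
      using near(2) d01 dist_components_le(1)[of y0 y1] norm_triangle_ineq2[of "fst y1" "fst y0"]
      by (simp add: y0_def \<tau>_def norm_minus_commute distrib_right)
    have "\<bar>real_of_int (n * j)\<bar> * 1 \<le> \<bar>real_of_int (n * j)\<bar> * (\<delta> * \<tau>)"
      using near(1) by (intro mult_left_mono) (auto simp: y0_def \<tau>_def)
    also have "\<dots> \<le> min 1 s * \<tau>"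
      using mult_right_mono[OF \<delta>(3), of \<tau>] pos by (simp add: mult.assoc)
    finally have nj_le: "\<bar>real_of_int (n * j)\<bar> \<le> min 1 s * \<tau>"
      by simp
    have "dist y1 y2 \<le> \<bar>real_of_int (n * j)\<bar> + s * cmod (fst y1)"
      using displacement_le[of y1 \<beta> "n * j"] by (simp add: y2_def s_def)
    also have "\<dots> \<le> min 1 s * \<tau> + s * ((1 + Q) * \<tau>)"
      using nj_le w1 s(1) by (intro add_mono mult_left_mono) auto
    finally have d12: "dist y1 y2 \<le> min 1 s * \<tau> + s * ((1 + Q) * \<tau>)" .
    have in_ball: "y \<in> hyp_ball y0 L" if y: "height y = height y1" "dist y0 y \<le> (3 + 3 * Q) * \<tau>" for y
    proof -
      have "(dist y0 y)\<^sup>2 \<le> ((3 + 3 * Q) * \<tau>)\<^sup>2"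
        using y(2) by (intro power_mono) auto
      also have "\<dots> = (3 + 3 * Q)\<^sup>2 * \<tau> * \<tau>"
        by (simp add: power2_eq_square)
      also have "\<dots> \<le> (3 + 3 * Q)\<^sup>2 * \<tau> * (E * height y1)"
        using h1 pos by (intro mult_left_mono) auto
      also have "\<dots> = ((3 + 3 * Q)\<^sup>2 * E) * (\<tau> * height y1)"
        by simp
      also have "\<dots> < (2 * (cosh L - 1)) * (\<tau> * height y1)"
        using L_large_Q pos by (intro mult_strict_right_mono) auto
      finally show ?thesis
        using H(1) pos L_pos y(1) by (simp add: hyp_ball_def hyp_dist_less_iff mem_H4_iff \<tau>_def mult_ac)
    qed
    have y1_ball: "y1 \<in> hyp_ball y0 L"
    proof (rule in_ball)
      have "Q * \<tau> \<le> (3 + 3 * Q) * \<tau>"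
        using Q pos by (intro mult_right_mono) auto
      then show "dist y0 y1 \<le> (3 + 3 * Q) * \<tau>"
        using d01 by linarith
    qed simp
    have y2_ball: "y2 \<in> hyp_ball y0 L"
    proof (rule in_ball)
      have "dist y0 y2 \<le> Q * \<tau> + (1 * \<tau> + 2 * ((1 + Q) * \<tau>))"
      proof (rule order_trans[OF dist_triangle[of y0 y2 y1]], rule add_mono[OF d01])
        show "dist y1 y2 \<le> 1 * \<tau> + 2 * ((1 + Q) * \<tau>)"
          using pos Q s by (intro order_trans[OF d12] add_mono mult_right_mono) auto
      qed
      then show "dist y0 y2 \<le> (3 + 3 * Q) * \<tau>"
        by (simp add: algebra_simps)
    qed (simp add: y2_def)
    have y2_eq: "y2 = \<Phi> (screw_power \<alpha> j x1)"
      using equivariant[OF x1] by (simp add: y2_def y1_def)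
    have "2 * k * dist y1 y2 \<le> 2 * k * (s * \<tau> + s * ((1 + Q) * \<tau>))"
      using k pos by (intro mult_left_mono order_trans[OF d12] add_right_mono mult_right_mono) auto
    also have "\<dots> = 2 * k * (2 + Q) * s * \<tau>"
      by (simp add: algebra_simps)
    also have "\<dots> \<le> 2 * k * (2 + Q) * s * (E * height y1)"
      using h1 k Q s by (intro mult_left_mono) auto
    also have "\<dots> = (q * s) * height y1"
      by (simp add: q_def)
    finally have M: "2 * k * dist y1 y2 / height y1 \<le> q * s"
      using pos by (simp add: pos_divide_le_eq)
    have "dist x1 (screw_power \<alpha> j x1) \<le> (q * s) * exp (2 * (q * s)) * height x1"
    proof (rule preimage_along_segment[OF n_nonzero x1 _ _ pos(2)])
      have "closed_segment y1 y2 \<subseteq> hyp_ball y0 L"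
        using y1_ball y2_ball H by (intro closed_segment_subset convex_hyp_ball)
      then show "closed_segment (\<Phi> x1) (\<Phi> (screw_power \<alpha> j x1)) \<subseteq> \<Phi> ` axis_cone a b"
        using covered by (simp add: y2_eq y1_def y0_def)
      show "height y1 \<le> height p" if "p \<in> closed_segment (\<Phi> x1) (\<Phi> (screw_power \<alpha> j x1))" for p
        using height_on_horizontal_segment[OF _ _ that, of "height y1"]
        by (simp add: y1_def y2_def flip: y2_eq)
      show "2 * k * dist (\<Phi> x1) (\<Phi> (screw_power \<alpha> j x1)) / height y1 \<le> q * s"
        using M by (simp add: y2_eq y1_def)
    qed (use x1 in simp)
    moreover have "rotation_size (\<alpha> * of_int j) * t \<le> dist x1 (screw_power \<alpha> j x1)"
      using displacement_ge_rotation[of \<alpha> j x1] t by (simp add: x1_def)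
    ultimately have "rotation_size (\<alpha> * of_int j) * t \<le> ((q * s) * exp (2 * (q * s))) * t"
      by (simp add: x1_def)
    then have "rotation_size (\<alpha> * of_int j) \<le> (q * s) * exp (2 * (q * s))"
      using t(2) by (rule mult_right_le_imp_le)
    also have "\<dots> \<le> (q * s) * exp (4 * q)"
      using s q mult_left_mono[OF s(2) q] by (intro mult_left_mono) auto
    finally show ?thesis
      by (simp add: s_def mult_ac)
  qed
  then show ?thesis
    using that by blast
qed

lemma angles_equal_up_to_sign: "\<alpha> - \<beta> \<in> \<int> \<or> \<alpha> + \<beta> \<in> \<int>"
proof -
  obtain B1 where B1: "\<And>j. j \<noteq> 0 \<Longrightarrow> rotation_size (\<beta> * of_int (n * j)) \<le> B1 * rotation_size (\<alpha> * of_int j)"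
    using rotation_size_image_le by blast
  obtain B2 where B2: "\<And>j. j \<noteq> 0 \<Longrightarrow> rotation_size (\<alpha> * of_int j) \<le> B2 * rotation_size (\<beta> * of_int (n * j))"
    using rotation_size_le_image by blast
  have "n = 1 \<or> n = -1"
    using abs_n_eq_1 by auto
  then have n: "rotation_size (\<beta> * of_int (n * j)) = rotation_size (\<beta> * of_int j)" for j
    by auto
  define B where "B = max 1 (max B1 B2)"
  have B: "B1 * r \<le> B * r" "B2 * r \<le> B * r" if "0 \<le> r" for r
    using that by (auto simp: B_def intro!: mult_right_mono)
  show ?thesis
  proof (rule comparable_rotations_imp_eq[OF irrational(1)])
    show "1 \<le> B"
      by (simp add: B_def)
    show "rotation_size (\<beta> * of_int j) \<le> B * rotation_size (\<alpha> * of_int j)" for j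
      using B1[of j] B(1)[of "rotation_size (\<alpha> * of_int j)"]
      by (cases "j = 0") (auto simp: n rotation_size_eq_0_iff[THEN iffD2] simp del: of_int_mult)
    show "rotation_size (\<alpha> * of_int j) \<le> B * rotation_size (\<beta> * of_int j)" for j
      using B2[of j] B(2)[of "rotation_size (\<beta> * of_int j)"]
      by (cases "j = 0") (auto simp: n rotation_size_eq_0_iff[THEN iffD2] simp del: of_int_mult)
  qed
qed

end

section \<open>Rigidity of Margulis cusps\<close>

theorem theoremB:
  fixes \<epsilon> \<alpha> \<beta> :: real
  assumes "0 < \<epsilon>" and "\<epsilon> \<le> margulis_constant"
    and "\<alpha> \<notin> \<rat>" and "\<beta> \<notin> \<rat>"
    and "\<exists>\<phi>. bilipschitz_embedding (margulis_cusp \<epsilon> \<alpha>) cusp_dist (margulis_cusp \<epsilon> \<beta>) cusp_dist \<phi>"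
  shows "\<alpha> - \<beta> \<in> \<int> \<or> \<alpha> + \<beta> \<in> \<int>"
proof -
  obtain \<phi> where "bilipschitz_embedding (margulis_cusp \<epsilon> \<alpha>) cusp_dist (margulis_cusp \<epsilon> \<beta>) cusp_dist \<phi>"
    using assms(5) by blast
  then obtain Y :: "point \<Rightarrow> point" and k where k: "1 \<le> k"
    and Y_region: "\<And>x. x \<in> margulis_region \<epsilon> \<alpha> \<Longrightarrow> Y x \<in> margulis_region \<epsilon> \<beta>"
    and Y_screw: "\<And>x j. Y (screw_power \<alpha> j x) = Y x"
    and Y_upper: "\<And>x x' e. \<lbrakk>x \<in> margulis_region \<epsilon> \<alpha>; x' \<in> margulis_region \<epsilon> \<alpha>; hyp_dist x x' < e\<rbrakk>
      \<Longrightarrow> \<exists>j. hyp_dist (Y x) (screw_power \<beta> j (Y x')) < k * e"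
    and Y_lower: "\<And>x x' j e. \<lbrakk>x \<in> margulis_region \<epsilon> \<alpha>; x' \<in> margulis_region \<epsilon> \<alpha>;
        hyp_dist (Y x) (screw_power \<beta> j (Y x')) < e\<rbrakk>
      \<Longrightarrow> \<exists>m. hyp_dist x (screw_power \<alpha> m x') < k * e"
    by (rule bilipschitz_embedding_representatives) blast
  define K where "K = (3 + 3 * (2 * k * exp (4 * k)))\<^sup>2 * exp (4 * k)"
  have "\<forall>\<^sub>F L :: real in at_top. 1 + K / 2 < cosh L"
    using cosh_real_at_top by (auto simp: filterlim_at_top_dense)
  then have "\<forall>\<^sub>F L :: real in at_top. 1 + K / 2 < cosh L \<and> \<epsilon> \<le> L"
    using eventually_ge_at_top[of \<epsilon>] by (rule eventually_conj)
  from eventually_happens'[OF trivial_limit_at_top_linorder this]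
  obtain L :: real where L: "1 + K / 2 < cosh L" "\<epsilon> \<le> L"
    by blast
  define a where "a = 1 / (8 * (cosh (k * L))\<^sup>2)"
  have a: "0 < a"
    by (simp add: a_def)
  obtain b where b: "0 \<le> b" and sub: "axis_cone a b \<subseteq> margulis_region \<epsilon> \<alpha>"
    using axis_cone_subset_margulis_region[OF assms(1) a] by blast
  have region_H4: "margulis_region \<epsilon> \<beta> \<subseteq> H4"
    by (auto simp: margulis_region_iff)
  have cone: "convex (axis_cone a b)" "axis_cone a b \<subseteq> H4"
    using a b by (simp_all add: convex_axis_cone axis_cone_H4)
  obtain \<Phi> n where \<Phi>: "continuous_on (axis_cone a b) \<Phi>"
    "\<And>x. x \<in> axis_cone a b \<Longrightarrow> \<exists>i. \<Phi> x = screw_power \<beta> i (Y x)"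
    "\<And>x m. x \<in> axis_cone a b \<Longrightarrow> \<Phi> (screw_power \<alpha> m x) = screw_power \<beta> (n * m) (\<Phi> x)"
  proof (rule lift_quotient_map[OF cone _ _ _ k, of \<alpha> Y \<beta>])
    show "\<exists>j. hyp_dist (Y x) (screw_power \<beta> j (Y x')) < k * e"
      if "x \<in> axis_cone a b" "x' \<in> axis_cone a b" "hyp_dist x x' < e" for x x' e
      using Y_upper that sub by blast
    show "Y x \<in> H4" if "x \<in> axis_cone a b" for x
      using Y_region that sub region_H4 by blast
  qed (use Y_screw in auto)
  have \<Phi>_region: "\<Phi> ` axis_cone a b \<subseteq> margulis_region \<epsilon> \<beta>"
    using \<Phi>(2) Y_region sub by fastforce
  interpret cone_embedding \<alpha> \<beta> k a b \<Phi> n \<epsilon> L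
  proof unfold_locales
    show "\<Phi> ` axis_cone a b \<subseteq> H4"
      using \<Phi>_region region_H4 by blast
    show "\<exists>j. hyp_dist (\<Phi> x) (screw_power \<beta> j (\<Phi> x')) < k * e"
      if x: "x \<in> axis_cone a b" "x' \<in> axis_cone a b" and "hyp_dist x x' < e" for x x' e
    proof -
      obtain i i' where i: "\<Phi> x = screw_power \<beta> i (Y x)" "\<Phi> x' = screw_power \<beta> i' (Y x')"
        using \<Phi>(2) x by meson
      obtain j where "hyp_dist (Y x) (screw_power \<beta> j (Y x')) < k * e"
        using Y_upper \<open>hyp_dist x x' < e\<close> x sub by blast
      then show ?thesis
        by (intro exI[of _ "j + i - i'"]) (simp add: i hyp_dist_screw_power_left)
    qed
    show "\<exists>m. hyp_dist x (screw_power \<alpha> m x') < k * e"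
      if x: "x \<in> axis_cone a b" "x' \<in> axis_cone a b" and d: "hyp_dist (\<Phi> x) (screw_power \<beta> j (\<Phi> x')) < e" for x x' j e
    proof -
      obtain i i' where i: "\<Phi> x = screw_power \<beta> i (Y x)" "\<Phi> x' = screw_power \<beta> i' (Y x')"
        using \<Phi>(2) x by meson
      have "hyp_dist (Y x) (screw_power \<beta> (j + i' - i) (Y x')) < e"
        using d by (simp add: i hyp_dist_screw_power_left)
      then show ?thesis
        using Y_lower x sub by blast
    qed
    show "(3 + 3 * (2 * k * exp (4 * k)))\<^sup>2 * exp (4 * k) < 2 * (cosh L - 1)"
    proof -
      have "K < 2 * (cosh L - 1)"
        using L(1) by (simp add: field_simps)
      then show ?thesis
        by (simp only: K_def)
    qed
  qed (use k open_axis_cone cone \<Phi> \<Phi>_region assms L(2) b a_def in auto)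
  show ?thesis
    by (rule angles_equal_up_to_sign)
qed

end
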